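(* Let $s\ge0$ be an integer, let $(N^2,\langle\cdot,\cdot\rangle)$ be a two-dimensional Riemannian manifold with constant sectional curvature $K\ge0$, and let $\gamma:I\to N^2$ be a $(2s+1)$-harmonic curve parametrized by arc length, where $I\subset\mathbb R$ is an open interval. If the geodesic curvature $\kappa$ of $\gamma$ is constant, then $\kappa=\sqrt{2sK}$.
   Context: Frenet frame: $T=\gamma'$, and $\mathbf n$ is a smooth unit normal field along $\gamma$ with $\nabla^N_{\gamma'}T=\kappa\,\mathbf n$, $\nabla^N_{\gamma'}\mathbf n=-\kappa T$; $\kappa$ is the geodesic curvature and $\nabla^N$ the Levi-Civita connection. For a smooth curve $\gamma:I\to N$ the tension field is $\tau(\gamma)=\nabla^N_{\gamma'}\gamma'$ and the $k$-energy is $E_k(\gamma)=\frac12\int\|(\nabla^N_{\gamma'})^{k-1}\gamma'\|^2dt$ (this is the specialization to curves of $E_k(\phi)=\frac12\int\|(d+d^* )^k\phi\|^2v_g$). The curve is $k$-harmonic if it is a critical point of $E_k$ under all smooth compactly supported variations (the energy being integrated over a compact set containing the support), the varied curves not being required to be parametrized by arc length.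
   Formalization: The conclusion is "κ vanishes identically or |κ| = √(2sK)": geodesics (e.g. great circles, s ≥ 1, K > 0) are (2s+1)-harmonic with κ = 0, and replacing the unit normal n by −n changes the sign of κ, so κ = √(2sK) holds only for κ > 0, or when sK = 0. *)

theory Defs
  imports "HOL-Analysis.Analysis"
begin

section \<open>Smooth maps between Euclidean spaces\<close>

text \<open>Both notions are meant for an open set \<open>S\<close>; the derivatives are full derivatives at the
  points of \<open>S\<close>, and every iterated directional derivative is required to exist.\<close>

fun higher_differentiable_on ::
  "nat \<Rightarrow> 'a::euclidean_space set \<Rightarrow> ('a \<Rightarrow> 'b::euclidean_space) \<Rightarrow> bool" where
  "higher_differentiable_on 0 S f \<longleftrightarrow> continuous_on S f"
| "higher_differentiable_on (Suc n) S f \<longleftrightarrow>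
     (\<forall>x\<in>S. f differentiable (at x)) \<and>
     (\<forall>v. higher_differentiable_on n S (\<lambda>x. frechet_derivative f (at x) v))"

definition smooth_on :: "'a::euclidean_space set \<Rightarrow> ('a \<Rightarrow> 'b::euclidean_space) \<Rightarrow> bool" where
  "smooth_on S f \<longleftrightarrow> (\<forall>n. higher_differentiable_on n S f)"


section \<open>Riemannian manifolds\<close>

text \<open>A chart is a domain together with a coordinate map with values in the model space; the values
  of the coordinate map outside the domain are irrelevant.  The metric is given by its coordinate
  expressions: \<open>metric_coeff N c x u v\<close> is the product of the vectors with components \<open>u\<close> and \<open>v\<close>
  in the chart \<open>c\<close>, at the point with coordinates \<open>x\<close>.\<close>

type_synonym ('a, 'e) chart = "'a set \<times> ('a \<Rightarrow> 'e)"

abbreviation chart_dom :: "('a, 'e) chart \<Rightarrow> 'a set" where "chart_dom \<equiv> fst"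
abbreviation coord :: "('a, 'e) chart \<Rightarrow> 'a \<Rightarrow> 'e" where "coord \<equiv> snd"
abbreviation chart_im :: "('a, 'e) chart \<Rightarrow> 'e set" where "chart_im c \<equiv> coord c ` chart_dom c"

definition transition :: "('a, 'e) chart \<Rightarrow> ('a, 'e) chart \<Rightarrow> 'e \<Rightarrow> 'e" where
  "transition c d x = coord d (inv_into (chart_dom c) (coord c) x)"

record ('a, 'e) riem =
  top_of :: "'a topology"
  atlas :: "('a, 'e) chart set"
  metric_coeff :: "('a, 'e) chart \<Rightarrow> 'e \<Rightarrow> 'e \<Rightarrow> 'e \<Rightarrow> real"

locale riemannian_manifold =
  fixes N :: "('a, 'e::euclidean_space) riem"
  assumes hausdorff: "Hausdorff_space (top_of N)"
    and second_countable: "second_countable (top_of N)"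
    and atlas_covers: "(\<Union>c\<in>atlas N. chart_dom c) = topspace (top_of N)"
    and chart_dom_open: "c \<in> atlas N \<Longrightarrow> openin (top_of N) (chart_dom c)"
    and chart_im_open: "c \<in> atlas N \<Longrightarrow> open (chart_im c)"
    and chart_homeomorphic:
      "c \<in> atlas N \<Longrightarrow>
         homeomorphic_map (subtopology (top_of N) (chart_dom c)) (top_of_set (chart_im c)) (coord c)"
    and transition_smooth:
      "c \<in> atlas N \<Longrightarrow> d \<in> atlas N \<Longrightarrow>
         smooth_on (coord c ` (chart_dom c \<inter> chart_dom d)) (transition c d)"
    and metric_bilinear:
      "c \<in> atlas N \<Longrightarrow> x \<in> chart_im c \<Longrightarrow> bilinear (metric_coeff N c x)"
    and metric_sym:
      "c \<in> atlas N \<Longrightarrow> x \<in> chart_im c \<Longrightarrow> metric_coeff N c x u v = metric_coeff N c x v u"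
    and metric_pos:
      "c \<in> atlas N \<Longrightarrow> x \<in> chart_im c \<Longrightarrow> u \<noteq> 0 \<Longrightarrow> metric_coeff N c x u u > 0"
    and metric_smooth:
      "c \<in> atlas N \<Longrightarrow> smooth_on (chart_im c) (\<lambda>x. metric_coeff N c x u v)"
    and metric_transition:
      "c \<in> atlas N \<Longrightarrow> d \<in> atlas N \<Longrightarrow> p \<in> chart_dom c \<inter> chart_dom d \<Longrightarrow>
         metric_coeff N c (coord c p) u v =
         metric_coeff N d (coord d p)
           (frechet_derivative (transition c d) (at (coord c p)) u)
           (frechet_derivative (transition c d) (at (coord c p)) v)"

text \<open>The Levi-Civita connection in the chart \<open>c\<close>: the unique bilinear
  \<open>\<Gamma> u v = \<Gamma>\<^sup>k\<^sub>i\<^sub>j u\<^sup>i v\<^sup>j\<close> which is torsion-free and compatible with the metric.\<close>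

definition levi_civita ::
  "('a, 'e::euclidean_space) riem \<Rightarrow> ('a, 'e) chart \<Rightarrow> 'e \<Rightarrow> 'e \<Rightarrow> 'e \<Rightarrow> 'e" where
  "levi_civita N c x = (THE \<Gamma>. bilinear \<Gamma> \<and> (\<forall>u v. \<Gamma> u v = \<Gamma> v u) \<and>
     (\<forall>z u v. frechet_derivative (\<lambda>y. metric_coeff N c y u v) (at x) z =
        metric_coeff N c x (\<Gamma> z u) v + metric_coeff N c x u (\<Gamma> z v)))"

text \<open>\<open>R(u,v)w = \<nabla>\<^sub>u\<nabla>\<^sub>v w - \<nabla>\<^sub>v\<nabla>\<^sub>u w\<close>, evaluated on coordinate fields (with constant components).\<close>

definition curvature ::
  "('a, 'e::euclidean_space) riem \<Rightarrow> ('a, 'e) chart \<Rightarrow> 'e \<Rightarrow> 'e \<Rightarrow> 'e \<Rightarrow> 'e \<Rightarrow> 'e" where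
  "curvature N c x u v w =
     frechet_derivative (\<lambda>y. levi_civita N c y v w) (at x) u
     - frechet_derivative (\<lambda>y. levi_civita N c y u w) (at x) v
     + levi_civita N c x u (levi_civita N c x v w)
     - levi_civita N c x v (levi_civita N c x u w)"

definition sectional_curvature ::
  "('a, 'e::euclidean_space) riem \<Rightarrow> ('a, 'e) chart \<Rightarrow> 'e \<Rightarrow> 'e \<Rightarrow> 'e \<Rightarrow> real" where
  "sectional_curvature N c x u v =
     metric_coeff N c x (curvature N c x u v v) u /
     (metric_coeff N c x u u * metric_coeff N c x v v - (metric_coeff N c x u v)\<^sup>2)"

definition constant_sectional_curvature :: "('a, 'e::euclidean_space) riem \<Rightarrow> real \<Rightarrow> bool" where
  "constant_sectional_curvature N K \<longleftrightarrow>
     (\<forall>c\<in>atlas N. \<forall>x\<in>chart_im c. \<forall>u v. u \<noteq> v \<and> independent {u, v} \<longrightarrow>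
        sectional_curvature N c x u v = K)"


section \<open>Tangent vectors and vector fields along curves\<close>

text \<open>A tangent vector at \<open>p\<close> is the family of its components in the charts around \<open>p\<close>, related by the
  transformation law; components in charts whose domain does not contain \<open>p\<close> do not matter.\<close>

type_synonym ('a, 'e) tangent = "('a, 'e) chart \<Rightarrow> 'e"

definition tangent_vector ::
  "('a, 'e::euclidean_space) riem \<Rightarrow> 'a \<Rightarrow> ('a, 'e) tangent \<Rightarrow> bool" where
  "tangent_vector N p v \<longleftrightarrow>
     (\<forall>c\<in>atlas N. \<forall>d\<in>atlas N. p \<in> chart_dom c \<inter> chart_dom d \<longrightarrow>
        v d = frechet_derivative (transition c d) (at (coord c p)) (v c))"

definition tangent_eq ::
  "('a, 'e) riem \<Rightarrow> 'a \<Rightarrow> ('a, 'e) tangent \<Rightarrow> ('a, 'e) tangent \<Rightarrow> bool" where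
  "tangent_eq N p u v \<longleftrightarrow> (\<forall>c\<in>atlas N. p \<in> chart_dom c \<longrightarrow> u c = v c)"

text \<open>For tangent vectors the choice of the chart is immaterial, by the transformation law of the
  metric.\<close>

definition riem_inner ::
  "('a, 'e) riem \<Rightarrow> 'a \<Rightarrow> ('a, 'e) tangent \<Rightarrow> ('a, 'e) tangent \<Rightarrow> real" where
  "riem_inner N p u v =
     (let c = (SOME c. c \<in> atlas N \<and> p \<in> chart_dom c)
      in metric_coeff N c (coord c p) (u c) (v c))"

definition smooth_into ::
  "('a, 'e::euclidean_space) riem \<Rightarrow> 'b::euclidean_space set \<Rightarrow> ('b \<Rightarrow> 'a) \<Rightarrow> bool" where
  "smooth_into N S f \<longleftrightarrow>
     continuous_map (top_of_set S) (top_of N) f \<and>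
     (\<forall>c\<in>atlas N. smooth_on (S \<inter> f -` chart_dom c) (\<lambda>x. coord c (f x)))"

definition smooth_field_along ::
  "('a, 'e::euclidean_space) riem \<Rightarrow> real set \<Rightarrow> (real \<Rightarrow> 'a) \<Rightarrow> (real \<Rightarrow> ('a, 'e) tangent) \<Rightarrow> bool"
  where
  "smooth_field_along N I \<gamma> V \<longleftrightarrow>
     (\<forall>t\<in>I. tangent_vector N (\<gamma> t) (V t)) \<and>
     (\<forall>c\<in>atlas N. smooth_on (I \<inter> \<gamma> -` chart_dom c) (\<lambda>t. V t c))"

definition velocity :: "(real \<Rightarrow> 'a) \<Rightarrow> real \<Rightarrow> ('a, 'e::euclidean_space) tangent" where
  "velocity \<gamma> t c = vector_derivative (\<lambda>r. coord c (\<gamma> r)) (at t)"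

definition cov_deriv ::
  "('a, 'e::euclidean_space) riem \<Rightarrow> (real \<Rightarrow> 'a) \<Rightarrow> (real \<Rightarrow> ('a, 'e) tangent) \<Rightarrow>
     real \<Rightarrow> ('a, 'e) tangent" where
  "cov_deriv N \<gamma> V t c =
     vector_derivative (\<lambda>r. V r c) (at t)
     + levi_civita N c (coord c (\<gamma> t)) (velocity \<gamma> t c) (V t c)"


section \<open>Polyharmonic curves and geodesic curvature\<close>

text \<open>The energy \<open>E\<^sub>k\<close> of the restriction of a curve to \<open>C\<close>, for \<open>k \<ge> 1\<close>.\<close>

definition k_energy ::
  "('a, 'e::euclidean_space) riem \<Rightarrow> nat \<Rightarrow> real set \<Rightarrow> (real \<Rightarrow> 'a) \<Rightarrow> real" where
  "k_energy N k C \<gamma> =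
     1 / 2 * integral C (\<lambda>t.
       let V = (cov_deriv N \<gamma> ^^ (k - 1)) (velocity \<gamma>) in riem_inner N (\<gamma> t) (V t) (V t))"

definition k_harmonic ::
  "('a, 'e::euclidean_space) riem \<Rightarrow> nat \<Rightarrow> real set \<Rightarrow> (real \<Rightarrow> 'a) \<Rightarrow> bool" where
  "k_harmonic N k I \<gamma> \<longleftrightarrow>
     smooth_into N I \<gamma> \<and>
     (\<forall>F e C. e > 0 \<and>
        smooth_into N ({-e<..<e} \<times> I) (\<lambda>(r, t). F r t) \<and>
        (\<forall>t\<in>I. F 0 t = \<gamma> t) \<and>
        compact C \<and> C \<subseteq> I \<and>
        (\<forall>r\<in>{-e<..<e}. \<forall>t\<in>I - C. F r t = \<gamma> t) \<longrightarrow>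
        ((\<lambda>r. k_energy N k C (F r)) has_real_derivative 0) (at 0))"

definition arc_length_param ::
  "('a, 'e::euclidean_space) riem \<Rightarrow> real set \<Rightarrow> (real \<Rightarrow> 'a) \<Rightarrow> bool" where
  "arc_length_param N I \<gamma> \<longleftrightarrow>
     (\<forall>t\<in>I. riem_inner N (\<gamma> t) (velocity \<gamma> t) (velocity \<gamma> t) = 1)"

text \<open>The unit normal field \<open>n\<close> is determined up to sign only, and so is the geodesic curvature
  \<open>\<kappa>\<close>, which may have zeros.\<close>

definition frenet_frame ::
  "('a, 'e::euclidean_space) riem \<Rightarrow> real set \<Rightarrow> (real \<Rightarrow> 'a) \<Rightarrow> (real \<Rightarrow> ('a, 'e) tangent) \<Rightarrow>
     (real \<Rightarrow> real) \<Rightarrow> bool" where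
  "frenet_frame N I \<gamma> n \<kappa> \<longleftrightarrow>
     smooth_field_along N I \<gamma> n \<and>
     (\<forall>t\<in>I. riem_inner N (\<gamma> t) (n t) (n t) = 1 \<and>
            riem_inner N (\<gamma> t) (n t) (velocity \<gamma> t) = 0 \<and>
            tangent_eq N (\<gamma> t) (cov_deriv N \<gamma> (velocity \<gamma>) t) (\<lambda>c. \<kappa> t *\<^sub>R n t c) \<and>
            tangent_eq N (\<gamma> t) (cov_deriv N \<gamma> n t) (\<lambda>c. - \<kappa> t *\<^sub>R velocity \<gamma> t c))"

end

theory Submission
  imports Defs "HOL-Computational_Algebra.Polynomial"
begin

text \<open>
  Let the geodesic curvature be a constant \<open>k \<noteq> 0\<close>.  Vary the curve in the normal direction,
  with variation field \<open>f \<^bold>n\<close> for a bump function \<open>f\<close> that is supported in one chart, and let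
  \<open>V\<^sub>j\<close> be the \<open>j\<close>-th covariant derivative of the velocity of the varied curves along themselves.
  The energy of order \<open>2 s + 1\<close> integrates half the square of the norm of \<open>V\<^sub>j\<close> for \<open>j = 2 s\<close>, so its
  derivative is the integral of \<open>\<langle>W\<^sub>j, V\<^sub>j\<rangle>\<close>, where \<open>W\<^sub>j\<close> is the covariant derivative of \<open>V\<^sub>j\<close> with
  respect to the variation parameter.

  Identify the frame \<open>T, \<^bold>n\<close> along the curve with \<open>1, \<i>\<close>.  By the Frenet equations the
  covariant derivative along the curve becomes \<open>d/dt + \<i> k\<close>, whence \<open>V\<^sub>j = (\<i> k)\<^sup>j\<close>; and since the
  curvature is the constant \<open>K\<close>, the endomorphism \<open>R(\<^bold>n, T)\<close> is multiplication by \<open>\<i> K\<close>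
  (\<open>curvature_orthonormal\<close>).  The connection is torsion-free, so \<open>W\<^sub>0\<close> is the covariant derivative of
  \<open>f \<^bold>n\<close>, and exchanging covariant derivatives shows that \<open>W\<^sub>j\<^sub>+\<^sub>1\<close> is the covariant derivative of
  \<open>W\<^sub>j\<close> plus \<open>f R(\<^bold>n, T) V\<^sub>j\<close>.  Integrating, the derivatives of compactly supported functions drop out,
  and what remains is a linear recursion for the integrals of the \<open>W\<^sub>j\<close>; its solution is \<open>(\<i> k)\<^sup>j (j K - k\<^sup>2) / k\<close>
  times the integral of \<open>f\<close> (\<open>integral_variation\<close>).  Up to a non-zero factor the derivative of the
  energy is therefore \<open>2 s K - k\<^sup>2\<close> (\<open>first_variation\<close>), and it vanishes.

  The inner product of tangent vectors is computed in a chart that is chosen anew at each point.  To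
  carry out the above in a single chart, the covariant derivatives of the velocity must be known to
  transform as tangent vectors, which comes down to the transformation law of the Christoffel
  symbols (\<open>levi_civita_transition\<close>).  This in turn needs the existence of the Levi-Civita connection
  (\<open>levi_civita_eq_sharp\<close>) and the symmetry of second derivatives (\<open>dir_deriv_commute\<close>).
\<close>

section \<open>Smooth functions between Euclidean spaces\<close>

subsection \<open>Directional derivatives\<close>

text \<open>The derivative in a fixed direction \<open>v\<close>, as an operation on functions; iterating it yields the
  functions whose existence smoothness is about.\<close>

abbreviation dir_deriv ::
  "'a \<Rightarrow> ('a::real_normed_vector \<Rightarrow> 'b::real_normed_vector) \<Rightarrow> 'a \<Rightarrow> 'b" ("\<partial>") where
  "\<partial> v f x \<equiv> frechet_derivative f (at x) v"

lemma has_derivative_dir_deriv: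
  "f differentiable (at x) \<Longrightarrow> (f has_derivative (\<lambda>v. \<partial> v f x)) (at x)"
  using frechet_derivative_works by (metis (no_types, lifting) eta_contract_eq has_derivative_eq_rhs)

lemma dir_deriv_eqI: "(f has_derivative f') (at x) \<Longrightarrow> \<partial> v f x = f' v"
  using frechet_derivative_at by metis

lemma dir_deriv_cong:
  "open S \<Longrightarrow> x \<in> S \<Longrightarrow> (\<And>y. y \<in> S \<Longrightarrow> f y = g y) \<Longrightarrow> f differentiable (at x) \<Longrightarrow> \<partial> v f x = \<partial> v g x"
  using frechet_derivative_transform_within_open by metis

lemma linear_dir_deriv: "f differentiable (at x) \<Longrightarrow> linear (\<lambda>v. \<partial> v f x)"
  using linear_frechet_derivative by (metis eta_contract_eq)

lemma differentiable_cong_open: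
  "open S \<Longrightarrow> x \<in> S \<Longrightarrow> (\<And>y. y \<in> S \<Longrightarrow> f y = g y) \<Longrightarrow> f differentiable (at x) \<Longrightarrow> g differentiable (at x)"
  unfolding differentiable_def using has_derivative_transform_within_open by blast

lemma dir_deriv_compose:
  assumes "f differentiable (at (g x))" "g differentiable (at x)"
  shows "\<partial> v (\<lambda>y. f (g y)) x = \<partial> (\<partial> v g x) f (g x)"
  by (rule dir_deriv_eqI, rule has_derivative_eq_rhs[OF has_derivative_compose])
     (use has_derivative_dir_deriv[OF assms(1)] has_derivative_dir_deriv[OF assms(2)] in auto)

lemma dir_deriv_in_basis:
  fixes f :: "'a::euclidean_space \<Rightarrow> 'b::real_normed_vector"
  assumes "f differentiable (at x)"
  shows "\<partial> v f x = (\<Sum>i\<in>Basis. (v \<bullet> i) *\<^sub>R \<partial> i f x)"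
proof -
  have "\<partial> v f x = \<partial> (\<Sum>i\<in>Basis. (v \<bullet> i) *\<^sub>R i) f x"
    by (simp add: euclidean_representation)
  then show ?thesis
    by (simp add: linear_sum[OF linear_dir_deriv[OF assms]] linear_scale[OF linear_dir_deriv[OF assms]])
qed

lemma vector_derivative_eq_dir_deriv:
  "f differentiable (at t) \<Longrightarrow> vector_derivative f (at t) = \<partial> 1 f t"
  by (simp add: frechet_derivative_eq_vector_derivative)

lemma has_vector_derivative_dir_deriv:
  "f differentiable (at t) \<Longrightarrow> (f has_vector_derivative \<partial> 1 f t) (at t)"
  using vector_derivative_eq_dir_deriv vector_derivative_works by metis

lemma dir_deriv_slice:
  assumes "Y differentiable (at (r, t))"
  shows "\<partial> h (\<lambda>t. Y (r, t)) t = \<partial> (0, h) Y (r, t)"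
proof -
  have "((\<lambda>t. (r, t)) has_derivative (\<lambda>h. (0, h))) (at t)"
    by (auto intro!: derivative_eq_intros)
  from has_derivative_compose[OF this has_derivative_dir_deriv[OF assms]]
  show ?thesis using dir_deriv_eqI by blast
qed

subsection \<open>Closure properties\<close>

lemma higher_differentiable_on_SucD:
  "higher_differentiable_on (Suc n) S f \<Longrightarrow> higher_differentiable_on n S f"
proof (induction n arbitrary: f)
  case 0
  then show ?case
    by (auto intro!: continuous_at_imp_continuous_on differentiable_imp_continuous_within)
next
  case (Suc n)
  then show ?case by (metis higher_differentiable_on.simps(2))
qed

lemma higher_differentiable_on_cong:
  assumes "open S" "higher_differentiable_on n S f" "\<And>x. x \<in> S \<Longrightarrow> f x = g x"
  shows "higher_differentiable_on n S g"
  using assms(2,3)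
proof (induction n arbitrary: f g)
  case 0
  then show ?case using continuous_on_cong by (metis higher_differentiable_on.simps(1))
next
  case (Suc n)
  have "g differentiable (at x)" if "x \<in> S" for x
    using Suc.prems differentiable_cong_open[OF assms(1) that, of f g] that by auto
  moreover have "higher_differentiable_on n S (\<partial> v g)" for v
    by (rule Suc.IH[of "\<partial> v f"])
       (use Suc.prems dir_deriv_cong[OF assms(1), of _ f g] in auto)
  ultimately show ?case by auto
qed

lemma higher_differentiable_on_subset:
  "higher_differentiable_on n S f \<Longrightarrow> T \<subseteq> S \<Longrightarrow> higher_differentiable_on n T f"
  by (induction n arbitrary: f) (auto intro: continuous_on_subset)

lemma higher_differentiable_on_local:
  assumes "\<And>x. x \<in> S \<Longrightarrow> \<exists>T. open T \<and> x \<in> T \<and> higher_differentiable_on n T f"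
  shows "higher_differentiable_on n S f"
  using assms
proof (induction n arbitrary: f)
  case 0
  have "continuous (at x) f" if "x \<in> S" for x
    using 0[OF that] continuous_on_eq_continuous_at by auto
  then show ?case by (auto intro: continuous_at_imp_continuous_on)
next
  case (Suc n)
  then have "f differentiable (at x)" if "x \<in> S" for x
    using that by (metis higher_differentiable_on.simps(2))
  moreover have "higher_differentiable_on n S (\<partial> v f)" for v
    by (rule Suc.IH) (use Suc.prems in \<open>metis higher_differentiable_on.simps(2)\<close>)
  ultimately show ?case by auto
qed

lemma higher_differentiable_on_const: "higher_differentiable_on n S (\<lambda>x. c)"
  by (induction n arbitrary: c) auto

lemma higher_differentiable_on_add:
  assumes "open S" "higher_differentiable_on n S f" "higher_differentiable_on n S g"
  shows "higher_differentiable_on n S (\<lambda>x. f x + g x)"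
  using assms(2,3)
proof (induction n arbitrary: f g)
  case 0
  then show ?case by (auto intro: continuous_intros)
next
  case (Suc n)
  have eq: "\<partial> v f x + \<partial> v g x = \<partial> v (\<lambda>x. f x + g x) x" if "x \<in> S" for x v
    by (rule sym, rule dir_deriv_eqI, rule has_derivative_add)
       (use Suc.prems that in \<open>auto intro!: has_derivative_dir_deriv\<close>)
  have "higher_differentiable_on n S (\<partial> v (\<lambda>x. f x + g x))" for v
    by (rule higher_differentiable_on_cong[OF assms(1) Suc.IH eq]) (use Suc.prems in auto)
  then show ?case using Suc.prems by auto
qed

lemma higher_differentiable_on_bilinear:
  assumes B: "bounded_bilinear B"
    and "open S" "higher_differentiable_on n S f" "higher_differentiable_on n S g"
  shows "higher_differentiable_on n S (\<lambda>x. B (f x) (g x))"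
  using assms(3,4)
proof (induction n arbitrary: f g)
  case 0
  then show ?case by (auto intro: bounded_bilinear.continuous_on[OF B])
next
  case (Suc n)
  have d: "((\<lambda>x. B (f x) (g x)) has_derivative (\<lambda>v. B (f x) (\<partial> v g x) + B (\<partial> v f x) (g x))) (at x)"
    if "x \<in> S" for x
    by (rule bounded_bilinear.FDERIV[OF B])
       (use Suc.prems that in \<open>auto intro!: has_derivative_dir_deriv\<close>)
  have "higher_differentiable_on n S (\<partial> v (\<lambda>x. B (f x) (g x)))" for v
    by (rule higher_differentiable_on_cong[OF assms(2) higher_differentiable_on_add[OF assms(2) Suc.IH Suc.IH]])
       (use Suc.prems higher_differentiable_on_SucD[of n S] dir_deriv_eqI[OF d] in auto)
  then show ?case using d differentiable_def by (metis higher_differentiable_on.simps(2))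
qed

lemma higher_differentiable_on_sum:
  assumes "open S" "finite A" "\<And>i. i \<in> A \<Longrightarrow> higher_differentiable_on n S (f i)"
  shows "higher_differentiable_on n S (\<lambda>x. \<Sum>i\<in>A. f i x)"
  using assms(2,3)
  by (induction rule: finite_induct)
     (auto intro!: higher_differentiable_on_const higher_differentiable_on_add[OF assms(1)])

lemma higher_differentiable_on_compose:
  fixes f :: "'b::euclidean_space \<Rightarrow> 'c::euclidean_space" and g :: "'a::euclidean_space \<Rightarrow> 'b"
  assumes "open S" "open T" "higher_differentiable_on n T f" "higher_differentiable_on n S g" "g ` S \<subseteq> T"
  shows "higher_differentiable_on n S (\<lambda>x. f (g x))"
  using assms(3,4)
proof (induction n arbitrary: f)
  case 0
  then show ?case using continuous_on_compose2 assms(5) by auto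
next
  case (Suc n)
  have df: "f differentiable (at (g x))" and dg: "g differentiable (at x)" if "x \<in> S" for x
    using Suc.prems that assms(5) by auto
  have g: "higher_differentiable_on n S g"
    using Suc.prems higher_differentiable_on_SucD by blast
  have eq: "(\<Sum>i\<in>Basis. (\<partial> v g x \<bullet> i) *\<^sub>R \<partial> i f (g x)) = \<partial> v (\<lambda>y. f (g y)) x" if "x \<in> S" for x v
    unfolding dir_deriv_compose[OF df[OF that] dg[OF that]] dir_deriv_in_basis[OF df[OF that], symmetric] ..
  have "higher_differentiable_on n S (\<partial> v (\<lambda>y. f (g y)))" for v
    by (rule higher_differentiable_on_cong[OF assms(1) higher_differentiable_on_sum eq])
       (auto intro!: assms(1) higher_differentiable_on_const
          higher_differentiable_on_bilinear[OF bounded_bilinear_scaleR]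
          higher_differentiable_on_bilinear[OF bounded_bilinear_inner] Suc.IH g
          simp: Suc.prems[simplified])
  moreover have "(\<lambda>y. f (g y)) differentiable (at x)" if "x \<in> S" for x
    using differentiable_chain_at[OF dg[OF that] df[OF that]] by (simp add: o_def)
  ultimately show ?case by simp
qed

lemma higher_differentiable_on_bounded_linear:
  "bounded_linear f \<Longrightarrow> higher_differentiable_on n S f"
proof (cases n)
  case 0
  assume "bounded_linear f"
  then show ?thesis using 0 linear_continuous_on by auto
next
  case (Suc m)
  assume f: "bounded_linear f"
  have eq: "\<partial> v f = (\<lambda>x. f v)" for v
    using dir_deriv_eqI[OF bounded_linear_imp_has_derivative[OF f]] by auto
  show ?thesis using Suc f
    by (auto simp: eq higher_differentiable_on_const bounded_linear_imp_differentiable)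
qed

lemma smooth_on_higher: "smooth_on S f \<Longrightarrow> higher_differentiable_on n S f"
  by (simp add: smooth_on_def)

lemma smooth_on_differentiable: "smooth_on S f \<Longrightarrow> x \<in> S \<Longrightarrow> f differentiable (at x)"
  by (metis higher_differentiable_on.simps(2) smooth_on_def)

lemma smooth_on_has_derivative:
  "smooth_on S f \<Longrightarrow> x \<in> S \<Longrightarrow> (f has_derivative (\<lambda>v. \<partial> v f x)) (at x)"
  by (simp add: has_derivative_dir_deriv smooth_on_differentiable)

lemma smooth_on_dir_deriv: "smooth_on S f \<Longrightarrow> smooth_on S (\<partial> v f)"
  by (metis higher_differentiable_on.simps(2) smooth_on_def)

lemma smooth_on_continuous: "smooth_on S f \<Longrightarrow> continuous_on S f"
  by (metis higher_differentiable_on.simps(1) smooth_on_def)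

lemma smooth_on_cong: "open S \<Longrightarrow> smooth_on S f \<Longrightarrow> (\<And>x. x \<in> S \<Longrightarrow> f x = g x) \<Longrightarrow> smooth_on S g"
  unfolding smooth_on_def using higher_differentiable_on_cong by blast

lemma smooth_on_subset: "smooth_on S f \<Longrightarrow> T \<subseteq> S \<Longrightarrow> smooth_on T f"
  unfolding smooth_on_def using higher_differentiable_on_subset by blast

lemma smooth_on_local:
  "(\<And>x. x \<in> S \<Longrightarrow> \<exists>T. open T \<and> x \<in> T \<and> smooth_on T f) \<Longrightarrow> smooth_on S f"
  unfolding smooth_on_def by (intro allI higher_differentiable_on_local) blast

lemma smooth_on_const: "smooth_on S (\<lambda>x. c)"
  unfolding smooth_on_def using higher_differentiable_on_const by blast

lemma smooth_on_add: "open S \<Longrightarrow> smooth_on S f \<Longrightarrow> smooth_on S g \<Longrightarrow> smooth_on S (\<lambda>x. f x + g x)"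
  unfolding smooth_on_def using higher_differentiable_on_add by blast

lemma smooth_on_sum:
  "open S \<Longrightarrow> finite A \<Longrightarrow> (\<And>i. i \<in> A \<Longrightarrow> smooth_on S (f i)) \<Longrightarrow> smooth_on S (\<lambda>x. \<Sum>i\<in>A. f i x)"
  unfolding smooth_on_def using higher_differentiable_on_sum by blast

lemma smooth_on_compose:
  "open S \<Longrightarrow> open T \<Longrightarrow> smooth_on T f \<Longrightarrow> smooth_on S g \<Longrightarrow> g ` S \<subseteq> T \<Longrightarrow> smooth_on S (\<lambda>x. f (g x))"
  unfolding smooth_on_def using higher_differentiable_on_compose by blast

lemma smooth_on_bounded_linear: "bounded_linear f \<Longrightarrow> smooth_on S f"
  unfolding smooth_on_def using higher_differentiable_on_bounded_linear by blast

lemma smooth_on_bounded_bilinear: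
  "bounded_bilinear B \<Longrightarrow> open S \<Longrightarrow> smooth_on S f \<Longrightarrow> smooth_on S g \<Longrightarrow> smooth_on S (\<lambda>x. B (f x) (g x))"
  unfolding smooth_on_def using higher_differentiable_on_bilinear by blast

lemmas smooth_on_scaleR = smooth_on_bounded_bilinear[OF bounded_bilinear_scaleR]
lemmas smooth_on_inner = smooth_on_bounded_bilinear[OF bounded_bilinear_inner]

lemma smooth_on_mult:
  fixes f g :: "'a::euclidean_space \<Rightarrow> real"
  shows "open S \<Longrightarrow> smooth_on S f \<Longrightarrow> smooth_on S g \<Longrightarrow> smooth_on S (\<lambda>x. f x * g x)"
  by (rule smooth_on_bounded_bilinear[OF bounded_bilinear_mult])

lemma smooth_on_diff:
  assumes "open S" "smooth_on S f" "smooth_on S g"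
  shows "smooth_on S (\<lambda>x. f x - g x)"
proof -
  have "smooth_on S (\<lambda>x. f x + (-1) *\<^sub>R g x)"
    by (intro smooth_on_add smooth_on_scaleR smooth_on_const assms)
  then show ?thesis by simp
qed

lemma smooth_on_inverse:
  fixes f :: "'a::euclidean_space \<Rightarrow> real"
  assumes "open S" "smooth_on S f" "\<And>x. x \<in> S \<Longrightarrow> f x \<noteq> 0"
  shows "smooth_on S (\<lambda>x. inverse (f x))"
  unfolding smooth_on_def
proof
  fix n
  show "higher_differentiable_on n S (\<lambda>x. inverse (f x))"
  proof (induction n)
    case 0
    then show ?case using smooth_on_continuous[OF assms(2)] assms(3)
      by (auto intro: continuous_intros)
  next
    case (Suc n)
    have d: "((\<lambda>x. inverse (f x)) has_derivative
        (\<lambda>v. ((- 1) * \<partial> v f x) * (inverse (f x) * inverse (f x)))) (at x)" if "x \<in> S" for x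
      by (rule has_derivative_eq_rhs, rule Deriv.has_derivative_inverse)
        (use assms that smooth_on_has_derivative in \<open>auto simp: ac_simps\<close>)
    have "higher_differentiable_on n S (\<lambda>x. ((- 1) * \<partial> v f x) * (inverse (f x) * inverse (f x)))" for v
      by (intro higher_differentiable_on_bilinear[OF bounded_bilinear_mult] assms(1) Suc
          higher_differentiable_on_const smooth_on_higher smooth_on_dir_deriv assms(2))
    then have "higher_differentiable_on n S (\<partial> v (\<lambda>x. inverse (f x)))" for v
      by (rule higher_differentiable_on_cong[OF assms(1)]) (simp only: dir_deriv_eqI[OF d])
    then show ?case using d differentiable_def by (metis higher_differentiable_on.simps(2))
  qed
qed

subsection \<open>Fields of linear and bilinear maps\<close>

lemma bilinear_linear_left: "bilinear B \<Longrightarrow> linear (\<lambda>u. B u v)"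
  and bilinear_linear_right: "bilinear B \<Longrightarrow> linear (B u)"
  by (auto simp: bilinear_def)

lemma bilinear_in_basis:
  fixes B :: "'e::euclidean_space \<Rightarrow> 'f::euclidean_space \<Rightarrow> 'c::real_vector"
  assumes "bilinear B"
  shows "B u v = (\<Sum>i\<in>Basis. \<Sum>j\<in>Basis. (u \<bullet> i) *\<^sub>R (v \<bullet> j) *\<^sub>R B i j)"
proof -
  have "B u v = B (\<Sum>i\<in>Basis. (u \<bullet> i) *\<^sub>R i) (\<Sum>j\<in>Basis. (v \<bullet> j) *\<^sub>R j)"
    by (simp add: euclidean_representation)
  also have "\<dots> = (\<Sum>i\<in>Basis. \<Sum>j\<in>Basis. (u \<bullet> i) *\<^sub>R (v \<bullet> j) *\<^sub>R B i j)"
    by (simp add: bilinear_sum[OF assms] sum.cartesian_product bilinear_lmul[OF assms] bilinear_rmul[OF assms] mult.commute)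
  finally show ?thesis .
qed

text \<open>In what follows \<open>B\<close> stands for a metric, for Christoffel symbols or for the differential of a
  change of coordinates, given as a field over the model space that is (bi)linear at each point and is
  smooth for fixed vector arguments.  The vector arguments and the base point may then all vary.\<close>

lemma smooth_on_bilinear_field:
  fixes B :: "'m::euclidean_space \<Rightarrow> 'e::euclidean_space \<Rightarrow> 'f::euclidean_space \<Rightarrow> 'c::euclidean_space"
    and x :: "'p::euclidean_space \<Rightarrow> 'm"
  assumes "open S" "open U" "smooth_on S x" "smooth_on S Y" "smooth_on S Z" "x ` S \<subseteq> U"
    and bil: "\<And>y. y \<in> U \<Longrightarrow> bilinear (B y)" and B: "\<And>u v. smooth_on U (\<lambda>y. B y u v)"
  shows "smooth_on S (\<lambda>p. B (x p) (Y p) (Z p))"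
proof (rule smooth_on_cong[OF assms(1)])
  show "smooth_on S (\<lambda>p. \<Sum>i\<in>Basis. \<Sum>j\<in>Basis. (Y p \<bullet> i) *\<^sub>R (Z p \<bullet> j) *\<^sub>R B (x p) i j)"
    by (intro smooth_on_sum smooth_on_scaleR smooth_on_inner smooth_on_const assms finite_Basis
          smooth_on_compose[OF assms(1,2) B assms(3,6)])
  show "(\<Sum>i\<in>Basis. \<Sum>j\<in>Basis. (Y p \<bullet> i) *\<^sub>R (Z p \<bullet> j) *\<^sub>R B (x p) i j) = B (x p) (Y p) (Z p)"
    if "p \<in> S" for p
    by (rule bilinear_in_basis[OF bil, symmetric]) (use assms(6) that in auto)
qed

lemma has_derivative_bilinear_field:
  fixes B :: "'m::euclidean_space \<Rightarrow> 'e::euclidean_space \<Rightarrow> 'f::euclidean_space \<Rightarrow> 'c::euclidean_space"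
    and x :: "'p::real_normed_vector \<Rightarrow> 'm"
  assumes U: "open U" "x p \<in> U"
    and bil: "\<And>y. y \<in> U \<Longrightarrow> bilinear (B y)" and B: "\<And>u v. smooth_on U (\<lambda>y. B y u v)"
    and x: "(x has_derivative x') (at p)" and Y: "(Y has_derivative Y') (at p)"
    and Z: "(Z has_derivative Z') (at p)"
  shows "((\<lambda>p. B (x p) (Y p) (Z p)) has_derivative
     (\<lambda>h. \<partial> (x' h) (\<lambda>y. B y (Y p) (Z p)) (x p) + B (x p) (Y' h) (Z p) + B (x p) (Y p) (Z' h))) (at p)"
proof -
  have cont: "isCont x p" using x has_derivative_continuous by blast
  obtain W where W: "open W" "p \<in> W" "x ` W \<subseteq> U"
    using continuous_at_open U cont by (metis (no_types, lifting) image_subsetI)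
  have Bx: "((\<lambda>p. B (x p) i j) has_derivative (\<lambda>h. \<partial> (x' h) (\<lambda>y. B y i j) (x p))) (at p)" for i j
    using has_derivative_compose[OF x smooth_on_has_derivative[OF B U(2)]] by simp
  let ?D = "\<lambda>h. \<Sum>i\<in>Basis. \<Sum>j\<in>Basis. (Y p \<bullet> i) *\<^sub>R ((Z p \<bullet> j) *\<^sub>R \<partial> (x' h) (\<lambda>y. B y i j) (x p)
           + (Z' h \<bullet> j) *\<^sub>R B (x p) i j) + (Y' h \<bullet> i) *\<^sub>R (Z p \<bullet> j) *\<^sub>R B (x p) i j"
  have d: "((\<lambda>p. \<Sum>i\<in>Basis. \<Sum>j\<in>Basis. (Y p \<bullet> i) *\<^sub>R (Z p \<bullet> j) *\<^sub>R B (x p) i j) has_derivative ?D) (at p)"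
    by (intro has_derivative_sum has_derivative_scaleR has_derivative_inner_left Y Z Bx)
  have dB: "((\<lambda>y. \<Sum>i\<in>Basis. \<Sum>j\<in>Basis. (Y p \<bullet> i) *\<^sub>R (Z p \<bullet> j) *\<^sub>R B y i j) has_derivative
      (\<lambda>h. \<Sum>i\<in>Basis. \<Sum>j\<in>Basis. (Y p \<bullet> i) *\<^sub>R (Z p \<bullet> j) *\<^sub>R \<partial> h (\<lambda>y. B y i j) (x p))) (at (x p))"
    by (intro has_derivative_sum has_derivative_scaleR_right smooth_on_has_derivative[OF B U(2)])
  have dB2: "\<partial> h (\<lambda>y. B y (Y p) (Z p)) (x p)
      = (\<Sum>i\<in>Basis. \<Sum>j\<in>Basis. (Y p \<bullet> i) *\<^sub>R (Z p \<bullet> j) *\<^sub>R \<partial> h (\<lambda>y. B y i j) (x p))" for h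
    by (rule dir_deriv_eqI, rule has_derivative_transform_within_open[OF dB U])
       (rule bilinear_in_basis[OF bil, symmetric])
  have D: "?D = (\<lambda>h. \<partial> (x' h) (\<lambda>y. B y (Y p) (Z p)) (x p) + B (x p) (Y' h) (Z p) + B (x p) (Y p) (Z' h))"
    unfolding dB2 bilinear_in_basis[OF bil[OF U(2)], of _ "Z p"] bilinear_in_basis[OF bil[OF U(2)], of "Y p"]
    by (intro ext) (simp add: sum.distrib scaleR_right_distrib add_ac)
  show ?thesis
    by (rule has_derivative_transform_within_open[OF d[unfolded D] W(1,2)])
       (rule bilinear_in_basis[OF bil, symmetric], use W(3) in auto)
qed

lemma bilinear_scaleR_linear: "linear L \<Longrightarrow> bilinear (\<lambda>u (a::real). a *\<^sub>R L u)"
  by (auto simp: bilinear_def linear_iff scaleR_right_distrib scaleR_left_distrib)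

text \<open>The linear version follows with the constant scalar \<open>1\<close> as second argument.\<close>

lemma has_derivative_linear_field:
  fixes B :: "'m::euclidean_space \<Rightarrow> 'e::euclidean_space \<Rightarrow> 'c::euclidean_space"
    and x :: "'p::real_normed_vector \<Rightarrow> 'm"
  assumes U: "open U" "x p \<in> U"
    and lin: "\<And>y. y \<in> U \<Longrightarrow> linear (B y)" and B: "\<And>u. smooth_on U (\<lambda>y. B y u)"
    and x: "(x has_derivative x') (at p)" and Y: "(Y has_derivative Y') (at p)"
  shows "((\<lambda>p. B (x p) (Y p)) has_derivative
     (\<lambda>h. \<partial> (x' h) (\<lambda>y. B y (Y p)) (x p) + B (x p) (Y' h))) (at p)"
  using has_derivative_bilinear_field[of U x p "\<lambda>y u (a::real). a *\<^sub>R B y u" x' Y Y' "\<lambda>_. 1" "\<lambda>_. 0"]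
    assms bilinear_scaleR_linear[OF lin] smooth_on_scaleR[OF U(1) smooth_on_const B]
  by simp

lemma linear_dir_deriv_field:
  assumes U: "open U" "x \<in> U" and lin: "\<And>y. y \<in> U \<Longrightarrow> linear (B y)"
    and B: "\<And>u. (\<lambda>y. B y u) differentiable (at x)"
  shows "linear (\<lambda>u. \<partial> z (\<lambda>y. B y u) x)"
proof (rule linearI)
  fix u v
  show "\<partial> z (\<lambda>y. B y (u + v)) x = \<partial> z (\<lambda>y. B y u) x + \<partial> z (\<lambda>y. B y v) x"
    by (rule dir_deriv_eqI, rule has_derivative_transform_within_open[OF has_derivative_add U])
       (auto intro!: has_derivative_dir_deriv B linear_add[OF lin, symmetric])
next
  fix r u
  show "\<partial> z (\<lambda>y. B y (r *\<^sub>R u)) x = r *\<^sub>R \<partial> z (\<lambda>y. B y u) x"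
    by (rule dir_deriv_eqI, rule has_derivative_transform_within_open[OF has_derivative_scaleR_right U])
       (auto intro!: has_derivative_dir_deriv B linear_scale[OF lin, symmetric])
qed

subsection \<open>Symmetry of second derivatives\<close>

text \<open>The increment of \<open>f\<close> in direction \<open>v\<close> is the integral of \<open>\<partial> v f\<close>; differentiating it in
  direction \<open>u\<close> under the integral sign and then in direction \<open>v\<close> by the fundamental theorem
  gives the symmetry.\<close>

lemma dir_deriv_commute:
  fixes f :: "'a::euclidean_space \<Rightarrow> 'b::euclidean_space"
  assumes S: "open S" and f: "smooth_on S f" and x: "x \<in> S"
  shows "\<partial> u (\<partial> v f) x = \<partial> v (\<partial> u f) x"
proof -
  define P where "P s t = x + s *\<^sub>R u + t *\<^sub>R v" for s t :: real
  obtain e where e: "e > 0" "ball x e \<subseteq> S" using S x open_contains_ball by blast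
  define d where "d = e / (norm u + norm v + 1)"
  have pos: "norm u + norm v + 1 > 0"
    by (smt (verit) norm_ge_zero)
  have d: "d > 0" unfolding d_def using e(1) pos by simp
  have PS: "P s t \<in> S" if "\<bar>s\<bar> < d" "\<bar>t\<bar> < d" for s t
  proof -
    have "norm (s *\<^sub>R u + t *\<^sub>R v) \<le> \<bar>s\<bar> * norm u + \<bar>t\<bar> * norm v"
      using norm_triangle_ineq[of "s *\<^sub>R u" "t *\<^sub>R v"] by simp
    also have "\<dots> \<le> d * norm u + d * norm v"
      using that by (intro add_mono mult_right_mono) auto
    also have "\<dots> < d * (norm u + norm v + 1)" using d by (simp add: algebra_simps)
    also have "\<dots> = e" unfolding d_def using pos by simp
    finally have "P s t \<in> ball x e"
      unfolding P_def mem_ball dist_norm by (metis add.assoc add_diff_cancel_left' norm_minus_commute)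
    then show ?thesis using e(2) by auto
  qed
  have vs: "((\<lambda>s. g (P s t)) has_vector_derivative \<partial> u g (P s t)) (at s)"
    if "smooth_on S g" "\<bar>s\<bar> < d" "\<bar>t\<bar> < d" for g :: "'a \<Rightarrow> 'b" and s t
  proof -
    have "((\<lambda>s. P s t) has_derivative (\<lambda>h. h *\<^sub>R u)) (at s)"
      unfolding P_def by (auto intro!: derivative_eq_intros)
    from has_derivative_compose[OF this smooth_on_has_derivative[OF that(1) PS[OF that(2,3)]]]
    show ?thesis unfolding has_vector_derivative_def
      using linear_scale[OF linear_dir_deriv[OF smooth_on_differentiable[OF that(1) PS[OF that(2,3)]]]] by simp
  qed
  have vt: "((\<lambda>t. g (P s t)) has_vector_derivative \<partial> v g (P s t)) (at t)"
    if "smooth_on S g" "\<bar>s\<bar> < d" "\<bar>t\<bar> < d" for g :: "'a \<Rightarrow> 'b" and s t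
  proof -
    have "((\<lambda>t. P s t) has_derivative (\<lambda>h. h *\<^sub>R v)) (at t)"
      unfolding P_def by (auto intro!: derivative_eq_intros)
    from has_derivative_compose[OF this smooth_on_has_derivative[OF that(1) PS[OF that(2,3)]]]
    show ?thesis unfolding has_vector_derivative_def
      using linear_scale[OF linear_dir_deriv[OF smooth_on_differentiable[OF that(1) PS[OF that(2,3)]]]] by simp
  qed
  have contP: "continuous_on A (\<lambda>(s, t). P s t)" for A :: "(real \<times> real) set"
    unfolding P_def by (auto simp: split_beta intro!: continuous_intros)
  have contP1: "continuous_on A (P s)" for A s
    unfolding P_def by (auto intro!: continuous_intros)
  have fv: "smooth_on S (\<partial> v f)" and fuv: "smooth_on S (\<partial> u (\<partial> v f))" and fu: "smooth_on S (\<partial> u f)"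
    by (auto intro!: smooth_on_dir_deriv f)
  \<comment> \<open>Only \<open>t \<ge> 0\<close> is considered: a one-sided derivative at \<open>0\<close> determines the value.\<close>
  let ?b = "d / 2"
  have eq: "\<partial> u f (P 0 t) - \<partial> u f (P 0 0) = integral {0..t} (\<lambda>\<tau>. \<partial> u (\<partial> v f) (P 0 \<tau>))"
    if t: "t \<in> {0..?b}" for t
  proof -
    have int: "integral {0..t} (\<lambda>\<tau>. \<partial> v f (P s \<tau>)) = f (P s t) - f (P s 0)" if "s \<in> {-d<..<d}" for s
      by (rule integral_unique, rule fundamental_theorem_of_calculus)
         (use t d that f in \<open>auto intro!: has_vector_derivative_at_within[OF vt]\<close>)
    have "((\<lambda>s. integral (cbox 0 t) (\<lambda>\<tau>. \<partial> v f (P s \<tau>))) has_vector_derivative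
        integral (cbox 0 t) (\<lambda>\<tau>. \<partial> u (\<partial> v f) (P 0 \<tau>))) (at 0 within {-d<..<d})"
    proof (rule leibniz_rule_vector_derivative)
      show "((\<lambda>s. \<partial> v f (P s \<tau>)) has_vector_derivative \<partial> u (\<partial> v f) (P s \<tau>)) (at s within {-d<..<d})"
        if "s \<in> {-d<..<d}" "\<tau> \<in> cbox 0 t" for s \<tau>
        by (rule has_vector_derivative_at_within[OF vs[OF fv]]) (use that t d in auto)
      show "(\<lambda>\<tau>. \<partial> v f (P s \<tau>)) integrable_on cbox 0 t" if "s \<in> {-d<..<d}" for s
        by (rule integrable_continuous)
          (rule continuous_on_compose2[OF smooth_on_continuous[OF fv] contP1], use that t d in \<open>auto intro!: PS\<close>)
      have "continuous_on ({-d<..<d} \<times> cbox 0 t) (\<lambda>z. \<partial> u (\<partial> v f) ((\<lambda>(s, t). P s t) z))"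
        by (rule continuous_on_compose2[OF smooth_on_continuous[OF fuv] contP])
           (use t d in \<open>auto intro!: PS\<close>)
      then show "continuous_on ({-d<..<d} \<times> cbox 0 t) (\<lambda>(s, \<tau>). \<partial> u (\<partial> v f) (P s \<tau>))"
        by (simp add: split_beta)
    qed (use d in auto)
    then have "((\<lambda>s. integral (cbox 0 t) (\<lambda>\<tau>. \<partial> v f (P s \<tau>))) has_vector_derivative
        integral (cbox 0 t) (\<lambda>\<tau>. \<partial> u (\<partial> v f) (P 0 \<tau>))) (at 0)"
      using d by (simp add: at_within_open[of 0 "{-d<..<d}"])
    then have 1: "((\<lambda>s. f (P s t) - f (P s 0)) has_vector_derivative
        integral (cbox 0 t) (\<lambda>\<tau>. \<partial> u (\<partial> v f) (P 0 \<tau>))) (at 0)"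
      by (rule has_vector_derivative_transform_within_open[where S="{-d<..<d}"]) (use int d in auto)
    have 2: "((\<lambda>s. f (P s t) - f (P s 0)) has_vector_derivative
        \<partial> u f (P 0 t) - \<partial> u f (P 0 0)) (at 0)"
      by (rule has_vector_derivative_diff) (rule vs[OF f], use t d in auto)+
    show ?thesis using vector_derivative_unique_at[OF 2 1] by simp
  qed
  have 1: "((\<lambda>t. integral {0..t} (\<lambda>\<tau>. \<partial> u (\<partial> v f) (P 0 \<tau>))) has_vector_derivative \<partial> u (\<partial> v f) (P 0 0))
      (at 0 within {0..?b})"
    by (rule integral_has_vector_derivative)
       (use d in \<open>auto intro!: continuous_on_compose2[OF smooth_on_continuous[OF fuv] contP1] PS\<close>)
  have 2: "((\<lambda>t. \<partial> u f (P 0 t) - \<partial> u f (P 0 0)) has_vector_derivative \<partial> v (\<partial> u f) (P 0 0))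
      (at 0 within {0..?b})"
    using has_vector_derivative_diff[OF has_vector_derivative_at_within[OF vt[OF fu]] has_vector_derivative_const] d
    by simp
  have "((\<lambda>t. integral {0..t} (\<lambda>\<tau>. \<partial> u (\<partial> v f) (P 0 \<tau>))) has_vector_derivative \<partial> v (\<partial> u f) (P 0 0))
      (at 0 within {0..?b})"
    by (rule has_vector_derivative_transform[OF _ _ 2]) (use d eq in auto)
  with 1 have "\<partial> u (\<partial> v f) (P 0 0) = \<partial> v (\<partial> u f) (P 0 0)"
    using vector_derivative_unique_within_closed_interval[of 0 ?b 0] d by auto
  then show ?thesis by (simp add: P_def)
qed

subsection \<open>Differentiation under the integral sign\<close>

lemma has_real_derivative_integral:
  fixes G :: "real \<times> real \<Rightarrow> real"
  assumes J: "open J" and G: "smooth_on ({-e<..<e} \<times> J) G" and e: "e > 0" and ab: "{a..b} \<subseteq> J"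
  shows "((\<lambda>r. integral {a..b} (\<lambda>t. G (r, t))) has_real_derivative
            integral {a..b} (\<lambda>t. \<partial> (1, 0) G (0, t))) (at 0)"
proof -
  have d: "((\<lambda>r. G (r, t)) has_vector_derivative \<partial> (1, 0) G (r, t)) (at r)"
    if "r \<in> {-e<..<e}" "t \<in> J" for r t
  proof -
    have G': "G differentiable (at (r, t))" using G that smooth_on_differentiable by blast
    have "((\<lambda>r. (r, t)) has_derivative (\<lambda>h. (h, 0))) (at r)"
      by (auto intro!: derivative_eq_intros)
    from has_derivative_compose[OF this has_derivative_dir_deriv[OF G']]
    have D: "((\<lambda>r. G (r, t)) has_derivative (\<lambda>h. \<partial> (h, 0) G (r, t))) (at r)" .
    have eq: "\<partial> (h, 0) G (r, t) = h *\<^sub>R \<partial> (1, 0) G (r, t)" for h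
      using linear_scale[OF linear_dir_deriv[OF G'], of h "(1, 0)"] by simp
    show ?thesis unfolding has_vector_derivative_def by (rule has_derivative_eq_rhs[OF D ext[OF eq]])
  qed
  have "((\<lambda>r. integral (cbox a b) (\<lambda>t. G (r, t))) has_vector_derivative
            integral (cbox a b) (\<lambda>t. \<partial> (1, 0) G (0, t))) (at 0 within {-e<..<e})"
  proof (rule leibniz_rule_vector_derivative[where fx = "\<lambda>r t. \<partial> (1, 0) G (r, t)"])
    show "((\<lambda>r. G (r, t)) has_vector_derivative \<partial> (1, 0) G (r, t)) (at r within {-e<..<e})"
      if "r \<in> {-e<..<e}" "t \<in> cbox a b" for r t
      using has_vector_derivative_at_within[OF d] that ab by auto
    show "(\<lambda>t. G (r, t)) integrable_on cbox a b" if "r \<in> {-e<..<e}" for r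
      by (rule integrable_continuous, rule continuous_on_compose2[OF smooth_on_continuous[OF G]])
         (use that ab in \<open>auto intro!: continuous_intros\<close>)
    have "continuous_on ({-e<..<e} \<times> cbox a b) (\<partial> (1, 0) G)"
      by (rule continuous_on_subset[OF smooth_on_continuous[OF smooth_on_dir_deriv[OF G]]]) (use ab in auto)
    then show "continuous_on ({-e<..<e} \<times> cbox a b) (\<lambda>(r, t). \<partial> (1, 0) G (r, t))"
      by (simp add: split_beta)
  qed (use e in auto)
  then show ?thesis
    using e by (simp add: at_within_open[of 0 "{-e<..<e}"] has_real_derivative_iff_has_vector_derivative)
qed

subsection \<open>Bump functions\<close>

text \<open>The functions \<open>t \<mapsto> p (1 / t) exp (- 1 / t)\<close> for \<open>t > 0\<close>, extended by \<open>0\<close>, where \<open>p\<close> is a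
  polynomial.  This class is closed under differentiation.\<close>

definition flat :: "real poly \<Rightarrow> real \<Rightarrow> real" where
  "flat p t = (if t > 0 then poly p (1 / t) * exp (- (1 / t)) else 0)"

lemma tendsto_poly_exp_neg_at_top: "((\<lambda>y::real. y ^ k * poly p y / exp y) \<longlongrightarrow> 0) at_top"
proof (induction p arbitrary: k)
  case 0
  then show ?case by simp
next
  case (pCons a p)
  have "((\<lambda>y. a * (y ^ k / exp y) + y ^ Suc k * poly p y / exp y) \<longlongrightarrow> a * 0 + 0) at_top"
    by (intro tendsto_intros tendsto_power_div_exp_0 pCons.IH)
  then show ?case by (simp add: algebra_simps add_divide_distrib)
qed

lemma tendsto_flat_0: "(flat p \<longlongrightarrow> 0) (at 0)"
proof -
  have "((\<lambda>t::real. poly p (1 / t) / exp (1 / t)) \<longlongrightarrow> 0) (at_right 0)"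
    using tendsto_poly_exp_neg_at_top[of 0 p] filterlim_inverse_at_top_right
    by (auto intro: filterlim_compose simp: inverse_eq_divide[symmetric])
  moreover have "\<forall>\<^sub>F t in at_right 0. poly p (1 / t) / exp (1 / t) = flat p t"
    unfolding eventually_at_right_field flat_def by (auto simp: exp_minus divide_inverse intro: exI[of _ 1])
  ultimately have "(flat p \<longlongrightarrow> 0) (at_right 0)" by (rule Lim_transform_eventually)
  moreover have "(flat p \<longlongrightarrow> 0) (at_left 0)"
    by (rule tendsto_eventually) (auto simp: eventually_at_left_field flat_def intro: exI[of _ "-1"])
  ultimately show ?thesis by (simp add: filterlim_split_at)
qed

lemma has_derivative_flat:
  "(flat p has_real_derivative flat ([:0, 0, 1:] * (p - pderiv p)) t) (at t)"
proof (cases t "0::real" rule: linorder_cases)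
  case less
  have "((\<lambda>_. 0) has_real_derivative flat ([:0, 0, 1:] * (p - pderiv p)) t) (at t)"
    using less by (auto simp: flat_def)
  then show ?thesis
    by (rule DERIV_cong_ev[OF refl _ refl, THEN iffD1, rotated])
       (use less in \<open>auto simp: eventually_nhds flat_def intro!: exI[of _ "{..<0}"]\<close>)
next
  case greater
  have "((\<lambda>t. poly p (1 / t) * exp (- (1 / t))) has_real_derivative
      flat ([:0, 0, 1:] * (p - pderiv p)) t) (at t)"
    using greater by (auto simp: flat_def field_simps power2_eq_square
        intro!: derivative_eq_intros DERIV_chain2[OF poly_DERIV])
  then show ?thesis
    by (rule DERIV_cong_ev[OF refl _ refl, THEN iffD1, rotated])
       (use greater in \<open>auto simp: eventually_nhds flat_def intro!: exI[of _ "{0<..}"]\<close>)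
next
  case equal
  have "((\<lambda>h. (flat p (0 + h) - flat p 0) / h) \<longlongrightarrow> 0) (at 0)"
    by (rule Lim_transform_eventually[OF tendsto_flat_0[of "pCons 0 p"]])
       (auto simp: flat_def eventually_at_filter)
  then show ?thesis using equal by (simp add: DERIV_def flat_def)
qed

lemma smooth_on_flat: "smooth_on UNIV (flat p)"
  unfolding smooth_on_def
proof
  fix n
  show "higher_differentiable_on n UNIV (flat p)"
  proof (induction n arbitrary: p)
    case 0
    then show ?case
      by (simp add: continuous_at_imp_continuous_on DERIV_continuous[OF has_derivative_flat])
  next
    case (Suc n)
    have "(flat p has_derivative (\<lambda>h. flat ([:0, 0, 1:] * (p - pderiv p)) t * h)) (at t)" for t
      using has_derivative_flat unfolding has_field_derivative_def .
    then have "flat p differentiable (at t)"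
      and "\<partial> v (flat p) = (\<lambda>t. flat ([:0, 0, 1:] * (p - pderiv p)) t * v)" for t v
      using dir_deriv_eqI by (blast intro: differentiableI, blast)
    then show ?case
      by (auto intro!: higher_differentiable_on_bilinear[OF bounded_bilinear_mult] Suc higher_differentiable_on_const)
  qed
qed

lemma bump_function_exists:
  fixes a b :: real
  assumes "a < b"
  obtains f :: "real \<Rightarrow> real" where "smooth_on UNIV f" "\<And>t. f t \<noteq> 0 \<Longrightarrow> a < t \<and> t < b" "integral {a..b} f \<noteq> 0"
proof -
  define f where "f t = flat 1 (t - a) * flat 1 (b - t)" for t
  have sm: "smooth_on UNIV f"
    unfolding f_def
    by (intro smooth_on_mult open_UNIV smooth_on_compose[OF open_UNIV open_UNIV smooth_on_flat]
        smooth_on_diff smooth_on_const smooth_on_bounded_linear bounded_linear_ident) auto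
  have nz: "a < t \<and> t < b" if "f t \<noteq> 0" for t using that by (auto simp: f_def flat_def split: if_splits)
  have ge: "f t \<ge> 0" for t by (auto simp: f_def flat_def)
  have "integral {a..b} f \<noteq> 0"
  proof
    assume "integral {a..b} f = 0"
    then have "\<forall>x\<in>{a..b}. f x = 0"
      using integral_eq_0_iff[of a b f] smooth_on_continuous[OF sm] continuous_on_subset assms ge by blast
    then have "f ((a + b) / 2) = 0" using assms by auto
    then show False using assms by (auto simp: f_def flat_def field_simps)
  qed
  with sm nz show ?thesis using that by blast
qed

section \<open>The Levi-Civita connection in a chart\<close>

context riemannian_manifold
begin

lemma chart_inj: "c \<in> atlas N \<Longrightarrow> inj_on (coord c) (chart_dom c)"
  using chart_homeomorphic[of c] chart_dom_open[of c] openin_subset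
  by (metis homeomorphic_map_def homeomorphic_eq_everything_map topspace_subtopology_subset)

lemma transition_coord:
  "c \<in> atlas N \<Longrightarrow> p \<in> chart_dom c \<Longrightarrow> transition c d (coord c p) = coord d p"
  unfolding transition_def using chart_inj inv_into_f_f by metis

lemma open_coord_image:
  assumes "c \<in> atlas N" "openin (top_of N) A" "A \<subseteq> chart_dom c"
  shows "open (coord c ` A)"
proof -
  have "openin (subtopology (top_of N) (chart_dom c)) A"
    using assms by (auto simp: openin_subtopology)
  then have "openin (top_of_set (chart_im c)) (coord c ` A)"
    using homeomorphic_imp_open_map[OF chart_homeomorphic[OF assms(1)]] by (auto simp: open_map_def)
  then show ?thesis using chart_im_open[OF assms(1)] openin_open_trans by blast
qed

lemma metric_differentiable:
  "c \<in> atlas N \<Longrightarrow> x \<in> chart_im c \<Longrightarrow> (\<lambda>x. metric_coeff N c x u v) differentiable (at x)"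
  using metric_smooth smooth_on_differentiable by blast

lemma metric_nondegenerate:
  assumes "c \<in> atlas N" "x \<in> chart_im c"
    and "\<And>w. metric_coeff N c x u w = metric_coeff N c x v w"
  shows "u = v"
proof (rule ccontr)
  assume "u \<noteq> v"
  then have "metric_coeff N c x (u - v) (u - v) > 0" using metric_pos assms by simp
  then show False using bilinear_lsub[OF metric_bilinear[OF assms(1,2)], of u v "u - v"] assms(3) by simp
qed

text \<open>The Koszul formula determines a symmetric connection that is compatible with the metric.\<close>

lemma koszul:
  assumes "\<And>u v. G u v = G v u"
    and "\<And>z u v. \<partial> z (\<lambda>y. metric_coeff N c y u v) x =
        metric_coeff N c x (G z u) v + metric_coeff N c x u (G z v)"
    and "c \<in> atlas N" "x \<in> chart_im c"
  shows "metric_coeff N c x (G u v) w = (\<partial> u (\<lambda>y. metric_coeff N c y v w) x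
     + \<partial> v (\<lambda>y. metric_coeff N c y u w) x - \<partial> w (\<lambda>y. metric_coeff N c y u v) x) / 2"
  unfolding assms(2) using assms(1)[of w] assms(1)[of v u] metric_sym[OF assms(3,4)] by (simp add: field_simps)

end

text \<open>In dimension two the Gram matrix of the metric can be inverted explicitly.\<close>

locale riemannian_surface = riemannian_manifold N for N :: "('a, real^2) riem"
begin

text \<open>The coefficients of the metric, and the Christoffel symbols as a bilinear map.\<close>

abbreviation g :: "('a, real^2) chart \<Rightarrow> real^2 \<Rightarrow> real^2 \<Rightarrow> real^2 \<Rightarrow> real" where
  "g \<equiv> metric_coeff N"

abbreviation Gam :: "('a, real^2) chart \<Rightarrow> real^2 \<Rightarrow> real^2 \<Rightarrow> real^2 \<Rightarrow> real^2" ("\<Gamma>") where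
  "\<Gamma> \<equiv> levi_civita N"

text \<open>The vector that represents a linear form \<open>l\<close> with respect to the metric, by Cramer's rule.  It is
  defined for any function \<open>l\<close>, but represents it only if \<open>l\<close> is linear.\<close>

definition sharp :: "('a, real^2) chart \<Rightarrow> real^2 \<Rightarrow> (real^2 \<Rightarrow> real) \<Rightarrow> real^2" where
  "sharp c x l = (let e = axis 1 1; e' = axis 2 1 in
     inverse (g c x e e * g c x e' e' - g c x e e' * g c x e e') *\<^sub>R
     ((l e * g c x e' e' - l e' * g c x e e') *\<^sub>R e + (l e' * g c x e e - l e * g c x e e') *\<^sub>R e'))"

lemma gram_determinant_pos:
  assumes "c \<in> atlas N" "x \<in> chart_im c"
  shows "g c x (axis 1 1) (axis 1 1) * g c x (axis 2 1) (axis 2 1)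
      - g c x (axis 1 1) (axis 2 1) * g c x (axis 1 1) (axis 2 1) > 0" (is "?D > 0")
proof -
  let ?e = "axis 1 1 :: real^2" and ?e' = "axis 2 1 :: real^2"
  note b = bilinear_ladd[OF metric_bilinear[OF assms]] bilinear_lmul[OF metric_bilinear[OF assms]]
     bilinear_radd[OF metric_bilinear[OF assms]] bilinear_rmul[OF metric_bilinear[OF assms]]
  define w where "w = g c x ?e' ?e' *\<^sub>R ?e + (- g c x ?e ?e') *\<^sub>R ?e'"
  have e': "g c x ?e' ?e' > 0" by (rule metric_pos[OF assms]) simp
  have "w $ 1 = g c x ?e' ?e'" by (simp add: w_def axis_def)
  with e' have "w \<noteq> 0" by auto
  then have "g c x w w > 0" using metric_pos assms by blast
  also have "g c x w w = g c x ?e' ?e' * ?D"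
    unfolding w_def b metric_sym[OF assms, of ?e' ?e] by (simp add: algebra_simps)
  finally show ?thesis using e' zero_less_mult_pos by blast
qed

lemma sharp:
  assumes "c \<in> atlas N" "x \<in> chart_im c" "linear l"
  shows "g c x (sharp c x l) w = l w"
proof -
  let ?e = "axis 1 1 :: real^2" and ?e' = "axis 2 1 :: real^2"
  let ?E = "g c x ?e ?e" and ?F = "g c x ?e ?e'" and ?G = "g c x ?e' ?e'"
  note b = bilinear_ladd[OF metric_bilinear[OF assms(1,2)]] bilinear_lmul[OF metric_bilinear[OF assms(1,2)]]
     bilinear_radd[OF metric_bilinear[OF assms(1,2)]] bilinear_rmul[OF metric_bilinear[OF assms(1,2)]]
  have w: "w = (w $ 1) *\<^sub>R ?e + (w $ 2) *\<^sub>R ?e'"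
    by (simp add: vec_eq_iff forall_2 axis_def)
  have D: "?E * ?G - ?F * ?F \<noteq> 0" using gram_determinant_pos[OF assms(1,2)] by simp
  have "g c x (sharp c x l) ?e = l ?e" "g c x (sharp c x l) ?e' = l ?e'"
    unfolding sharp_def Let_def b metric_sym[OF assms(1,2), of ?e' ?e] using D
    by (simp_all add: field_simps)
  then show ?thesis
    by (subst (1 2) w) (simp add: b linear_add[OF assms(3)] linear_scale[OF assms(3)])
qed

lemma sharp_add: "sharp c x (\<lambda>w. l w + l' w) = sharp c x l + sharp c x l'"
  and sharp_scaleR: "sharp c x (\<lambda>w. r * l w) = r *\<^sub>R sharp c x l"
  unfolding sharp_def Let_def by (simp_all add: vec_eq_iff algebra_simps)

text \<open>The right-hand side of the Koszul formula.\<close>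

definition koszul_form :: "('a, real^2) chart \<Rightarrow> real^2 \<Rightarrow> real^2 \<Rightarrow> real^2 \<Rightarrow> real^2 \<Rightarrow> real" where
  "koszul_form c x u v w =
     (\<partial> u (\<lambda>y. g c y v w) x + \<partial> v (\<lambda>y. g c y u w) x - \<partial> w (\<lambda>y. g c y u v) x) / 2"

context
  fixes c assumes c: "c \<in> atlas N"
begin

lemma linear_dir_metric:
  assumes x: "x \<in> chart_im c"
  shows "linear (\<lambda>z. \<partial> z (\<lambda>y. g c y u v) x)"
    and "linear (\<lambda>u. \<partial> z (\<lambda>y. g c y u v) x)" and "linear (\<lambda>v. \<partial> z (\<lambda>y. g c y u v) x)"
  using linear_dir_deriv[OF metric_differentiable[OF c x]]
    linear_dir_deriv_field[OF chart_im_open[OF c] x, of "\<lambda>y u. g c y u v"]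
    linear_dir_deriv_field[OF chart_im_open[OF c] x, of "\<lambda>y v. g c y u v"]
    metric_differentiable[OF c x] bilinear_linear_left[OF metric_bilinear[OF c]]
    bilinear_linear_right[OF metric_bilinear[OF c]]
  by blast+

lemma dir_metric_sym:
  assumes x: "x \<in> chart_im c"
  shows "\<partial> z (\<lambda>y. g c y u v) x = \<partial> z (\<lambda>y. g c y v u) x"
  by (rule dir_deriv_cong[OF chart_im_open[OF c] x]) (use metric_differentiable c x metric_sym in auto)

lemma koszul_form_linear:
  assumes x: "x \<in> chart_im c"
  shows "linear (koszul_form c x u v)"
    and "koszul_form c x (u + u') v w = koszul_form c x u v w + koszul_form c x u' v w"
    and "koszul_form c x (r *\<^sub>R u) v w = r * koszul_form c x u v w"
    and "koszul_form c x u v w = koszul_form c x v u w"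
proof -
  note l = linear_dir_metric[OF x, THEN linear_add] linear_dir_metric[OF x, THEN linear_scale]
  show "linear (koszul_form c x u v)"
    by (rule linearI) (simp_all add: koszul_form_def l algebra_simps add_divide_distrib diff_divide_distrib)
  show "koszul_form c x (u + u') v w = koszul_form c x u v w + koszul_form c x u' v w"
    "koszul_form c x (r *\<^sub>R u) v w = r * koszul_form c x u v w"
    by (simp_all add: koszul_form_def l algebra_simps add_divide_distrib diff_divide_distrib)
  show "koszul_form c x u v w = koszul_form c x v u w"
    unfolding koszul_form_def using dir_metric_sym[OF x, where z = w and u = u and v = v] by simp
qed

text \<open>The form \<open>koszul_form c x u v\<close> is represented by a unique vector, so that the connection exists and
  the definite description in its definition denotes it.\<close>

lemma levi_civita_eq_sharp:
  assumes x: "x \<in> chart_im c"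
  shows "\<Gamma> c x = (\<lambda>u v. sharp c x (koszul_form c x u v))" (is "_ = ?G")
    and "bilinear (\<Gamma> c x)" "\<Gamma> c x u v = \<Gamma> c x v u"
    and "\<partial> z (\<lambda>y. g c y u v) x = g c x (\<Gamma> c x z u) v + g c x u (\<Gamma> c x z v)"
proof -
  let ?P = "\<lambda>G. bilinear G \<and> (\<forall>u v. G u v = G v u) \<and>
     (\<forall>z u v. \<partial> z (\<lambda>y. metric_coeff N c y u v) x =
        metric_coeff N c x (G z u) v + metric_coeff N c x u (G z v))"
  note kf = koszul_form_linear[OF x]
  have sym: "?G u v = ?G v u" for u v using kf(4)[of u v] by presburger
  have lin: "linear (\<lambda>u. ?G u v)" for v
    by (rule linearI) (simp_all add: kf(2,3)[abs_def] sharp_add sharp_scaleR)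
  have bil: "bilinear ?G" unfolding bilinear_def using lin sym by simp
  have comp: "\<partial> z (\<lambda>y. g c y u v) x = g c x (?G z u) v + g c x u (?G z v)" for z u v
    unfolding sharp[OF c x kf(1)] metric_sym[OF c x, of u]
    using dir_metric_sym[OF x, where z = z and u = u and v = v] by (simp add: koszul_form_def field_simps)
  have ex: "?P ?G" using bil sym comp by blast
  have un: "G = ?G" if P: "?P G" for G
  proof (intro ext)
    fix u v
    show "G u v = ?G u v"
      using P koszul[of G c x, OF _ _ c x] sharp[OF c x kf(1)]
      by (intro metric_nondegenerate[OF c x]) (simp add: koszul_form_def)
  qed
  show eq: "\<Gamma> c x = ?G" unfolding levi_civita_def by (rule the_equality[of ?P, OF ex un])
  show "bilinear (\<Gamma> c x)" "\<Gamma> c x u v = \<Gamma> c x v u"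
    "\<partial> z (\<lambda>y. g c y u v) x = g c x (\<Gamma> c x z u) v + g c x u (\<Gamma> c x z v)"
    unfolding eq using bil sym comp by blast+
qed

lemmas levi_civita_bilinear = levi_civita_eq_sharp(2)
lemmas levi_civita_sym = levi_civita_eq_sharp(3)
lemmas levi_civita_metric = levi_civita_eq_sharp(4)

lemma smooth_on_levi_civita: "smooth_on (chart_im c) (\<lambda>x. \<Gamma> c x u v)"
proof (rule smooth_on_cong[OF chart_im_open[OF c]])
  have k: "smooth_on (chart_im c) (\<lambda>x. koszul_form c x u v w)" for w
    unfolding koszul_form_def divide_inverse
    by (intro smooth_on_mult smooth_on_add smooth_on_diff chart_im_open[OF c] smooth_on_dir_deriv
         metric_smooth[OF c] smooth_on_const)
  show "smooth_on (chart_im c) (\<lambda>x. sharp c x (koszul_form c x u v))"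
    unfolding sharp_def Let_def
    by (intro smooth_on_scaleR smooth_on_mult smooth_on_add smooth_on_diff smooth_on_inverse
         chart_im_open[OF c] metric_smooth[OF c] smooth_on_const k)
       (use gram_determinant_pos[OF c] in force)
qed (simp add: levi_civita_eq_sharp(1))

lemma levi_civita_differentiable: "x \<in> chart_im c \<Longrightarrow> (\<lambda>x. \<Gamma> c x u v) differentiable (at x)"
  using smooth_on_levi_civita smooth_on_differentiable by blast

section \<open>Curvature\<close>

lemma linear_dir_levi_civita:
  assumes x: "x \<in> chart_im c"
  shows "linear (\<lambda>u. \<partial> z (\<lambda>y. \<Gamma> c y u v) x)" and "linear (\<lambda>v. \<partial> z (\<lambda>y. \<Gamma> c y u v) x)"
  using linear_dir_deriv_field[OF chart_im_open[OF c] x, of "\<lambda>y u. \<Gamma> c y u v"]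
    linear_dir_deriv_field[OF chart_im_open[OF c] x, of "\<lambda>y v. \<Gamma> c y u v"]
    levi_civita_differentiable[OF x] bilinear_linear_left[OF levi_civita_bilinear]
    bilinear_linear_right[OF levi_civita_bilinear]
  by blast+

lemma curvature_linear:
  assumes x: "x \<in> chart_im c"
  shows "curvature N c x (r *\<^sub>R u) v w = r *\<^sub>R curvature N c x u v w"
    and "curvature N c x u v (r *\<^sub>R w) = r *\<^sub>R curvature N c x u v w"
    and "curvature N c x u v (w + w') = curvature N c x u v w + curvature N c x u v w'"
  unfolding curvature_def
  by (simp_all add: linear_dir_levi_civita[OF x, THEN linear_add] linear_dir_levi_civita[OF x, THEN linear_scale]
     linear_scale[OF linear_dir_deriv[OF levi_civita_differentiable[OF x]]]
     bilinear_ladd[OF levi_civita_bilinear[OF x]] bilinear_lmul[OF levi_civita_bilinear[OF x]]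
     bilinear_radd[OF levi_civita_bilinear[OF x]] bilinear_rmul[OF levi_civita_bilinear[OF x]] algebra_simps)

text \<open>Differentiating the compatibility with the metric once more: the second derivatives of the metric
  coefficients commute, and what is left after antisymmetrization is the curvature.\<close>

lemma curvature_skew:
  assumes x: "x \<in> chart_im c"
  shows "g c x (curvature N c x u v w) w' + g c x w (curvature N c x u v w') = 0"
proof -
  note b = bilinear_ladd[OF metric_bilinear[OF c x]] bilinear_radd[OF metric_bilinear[OF c x]]
    bilinear_lsub[OF metric_bilinear[OF c x]] bilinear_rsub[OF metric_bilinear[OF c x]]
  let ?k = "\<lambda>v y. g c y (\<Gamma> c y v w) w' + g c y w (\<Gamma> c y v w')"
  have d: "(?k v has_derivative (\<lambda>u. 
      (\<partial> u (\<lambda>y. g c y (\<Gamma> c x v w) w') x + g c x (\<partial> u (\<lambda>y. \<Gamma> c y v w) x) w' + g c x (\<Gamma> c x v w) 0) +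
      (\<partial> u (\<lambda>y. g c y w (\<Gamma> c x v w')) x + g c x 0 (\<Gamma> c x v w') + g c x w (\<partial> u (\<lambda>y. \<Gamma> c y v w') x)))) (at x)" for v
    by (intro has_derivative_add has_derivative_bilinear_field[where x = "\<lambda>y. y" and U = "chart_im c"] chart_im_open[OF c] x
        metric_bilinear[OF c] metric_smooth[OF c] has_derivative_ident has_derivative_const
        smooth_on_has_derivative[OF smooth_on_levi_civita x])
  have dd: "\<partial> u (\<partial> v (\<lambda>y. g c y w w')) x = 
      g c x (\<Gamma> c x u (\<Gamma> c x v w)) w' + g c x (\<Gamma> c x v w) (\<Gamma> c x u w') + g c x (\<partial> u (\<lambda>y. \<Gamma> c y v w) x) w'
      + g c x (\<Gamma> c x u w) (\<Gamma> c x v w') + g c x w (\<Gamma> c x u (\<Gamma> c x v w')) + g c x w (\<partial> u (\<lambda>y. \<Gamma> c y v w') x)" for u v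
  proof -
    have "\<partial> u (\<partial> v (\<lambda>y. g c y w w')) x = \<partial> u (?k v) x"
      by (rule dir_deriv_cong[OF chart_im_open[OF c] x levi_civita_metric])
         (use smooth_on_differentiable[OF smooth_on_dir_deriv[OF metric_smooth[OF c]] x] in auto)
    then show ?thesis
      unfolding dir_deriv_eqI[OF d] levi_civita_metric[OF x]
      by (simp add: bilinear_lzero[OF metric_bilinear[OF c x]] bilinear_rzero[OF metric_bilinear[OF c x]])
  qed
  have "\<partial> u (\<partial> v (\<lambda>y. g c y w w')) x = \<partial> v (\<partial> u (\<lambda>y. g c y w w')) x"
    by (rule dir_deriv_commute[OF chart_im_open[OF c] metric_smooth[OF c] x])
  then show ?thesis unfolding dd curvature_def b by simp
qed

text \<open>In an orthonormal frame \<open>R(n,T)\<close> is \<open>K\<close> times the rotation taking \<open>T\<close> to \<open>n\<close> and \<open>n\<close> to \<open>-T\<close>.\<close>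

lemma curvature_orthonormal:
  assumes K: "constant_sectional_curvature N K" and x: "x \<in> chart_im c"
    and on: "g c x T T = 1" "g c x n n = 1" "g c x n T = 0"
  shows "g c x (curvature N c x n T T) n = K" "g c x (curvature N c x n T T) T = 0"
    "g c x (curvature N c x n T n) n = 0" "g c x (curvature N c x n T n) T = - K"
proof -
  have "independent {n, T}"
  proof (rule independent_insertI)
    show "n \<notin> span {T}"
    proof
      assume "n \<in> span {T}"
      then obtain k where "n = k *\<^sub>R T" by (auto simp: span_singleton)
      then show False using on bilinear_lmul[OF metric_bilinear[OF c x]] by simp
    qed
    have "T \<noteq> 0" using on(1) bilinear_lzero[OF metric_bilinear[OF c x]] by auto
    then show "independent {T}" by simp
  qed
  moreover have "n \<noteq> T" using on by auto
  ultimately have "sectional_curvature N c x n T = K"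
    using K c x by (auto simp: constant_sectional_curvature_def)
  then show 1: "g c x (curvature N c x n T T) n = K"
    unfolding sectional_curvature_def using on by simp
  show "g c x (curvature N c x n T T) T = 0" "g c x (curvature N c x n T n) n = 0"
    using curvature_skew[OF x, of n T T T] curvature_skew[OF x, of n T n n] metric_sym[OF c x] by simp_all
  show "g c x (curvature N c x n T n) T = - K"
    using curvature_skew[OF x, of n T n T] metric_sym[OF c x, of n] 1 by simp
qed

end

section \<open>Change of charts\<close>

text \<open>The transformation law of the Christoffel symbols.  Both sides have the same inner products with all
  vectors, by the Koszul formula in the first chart and the invariance of the metric.\<close>

lemma levi_civita_transition:
  assumes c: "c \<in> atlas N" and d: "d \<in> atlas N" and p: "p \<in> chart_dom c \<inter> chart_dom d"
  defines "x \<equiv> coord c p" and "x' \<equiv> coord d p" and "\<phi> \<equiv> transition c d"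
  shows "\<partial> (\<Gamma> c x u v) \<phi> x = \<Gamma> d x' (\<partial> u \<phi> x) (\<partial> v \<phi> x) + \<partial> u (\<partial> v \<phi>) x"
proof -
  define W where "W = coord c ` (chart_dom c \<inter> chart_dom d)"
  have W: "open W" unfolding W_def
    using open_coord_image[OF c openin_Int[OF chart_dom_open[OF c] chart_dom_open[OF d]]] by auto
  have xW: "x \<in> W" and x: "x \<in> chart_im c" and x': "x' \<in> chart_im d" and \<phi>x: "\<phi> x = x'"
    using p by (auto simp: W_def x_def x'_def \<phi>_def transition_coord[OF c])
  have \<phi>: "smooth_on W \<phi>" unfolding W_def \<phi>_def by (rule transition_smooth[OF c d])
  note d\<phi> = smooth_on_differentiable[OF \<phi> xW]
  let ?A = "\<lambda>u. \<partial> u \<phi> x"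
  have A: "linear ?A" by (rule linear_dir_deriv[OF d\<phi>])
  have tr: "g c y u v = g d (\<phi> y) (\<partial> u \<phi> y) (\<partial> v \<phi> y)" if "y \<in> W" for y u v
    using that metric_transition[OF c d] by (auto simp: W_def \<phi>_def transition_coord[OF c])
  have inj: "inj ?A"
  proof (rule linear_injective_0[OF A, THEN iffD2], intro allI impI)
    fix u assume "?A u = 0"
    then have "g c x u u = 0"
      using tr[OF xW, of u u] \<phi>x bilinear_lzero[OF metric_bilinear[OF d x']] by simp
    then show "u = 0" using metric_pos[OF c x, of u] by auto
  qed
  \<comment> \<open>The inner products with the vectors \<open>?A w\<close> therefore suffice to identify a vector.\<close>
  have surj: "surj ?A" by (rule linear_injective_imp_surjective[OF A inj]) simp
  \<comment> \<open>In the coordinates of \<open>d\<close>, this is the covariant derivative in direction \<open>u\<close> of the field that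
    is constantly \<open>v\<close> in the coordinates of \<open>c\<close>.\<close>
  define S where "S u v = \<Gamma> d x' (?A u) (?A v) + \<partial> u (\<partial> v \<phi>) x" for u v
  have Ssym: "S u v = S v u" for u v
    unfolding S_def using levi_civita_sym[OF d x'] dir_deriv_commute[OF W \<phi> xW] by simp
  have k: "\<partial> u (\<lambda>y. g c y v w) x = g d x' (S u v) (?A w) + g d x' (?A v) (S u w)" for u v w
  proof -
    have "\<partial> u (\<lambda>y. g c y v w) x = \<partial> u (\<lambda>y. g d (\<phi> y) (\<partial> v \<phi> y) (\<partial> w \<phi> y)) x"
      by (rule dir_deriv_cong[OF W xW tr metric_differentiable[OF c x]])
    also have "\<dots> = \<partial> (\<partial> u \<phi> x) (\<lambda>y. g d y (\<partial> v \<phi> x) (\<partial> w \<phi> x)) (\<phi> x)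
         + g d (\<phi> x) (\<partial> u (\<partial> v \<phi>) x) (\<partial> w \<phi> x) + g d (\<phi> x) (\<partial> v \<phi> x) (\<partial> u (\<partial> w \<phi>) x)"
      by (rule dir_deriv_eqI, rule has_derivative_bilinear_field[OF chart_im_open[OF d]])
         (use x' \<phi>x metric_bilinear[OF d] metric_smooth[OF d] smooth_on_has_derivative[OF \<phi> xW]
           smooth_on_has_derivative[OF smooth_on_dir_deriv[OF \<phi>] xW] in auto)
    finally show ?thesis
      unfolding S_def \<phi>x levi_civita_metric[OF d x']
      by (simp add: bilinear_ladd[OF metric_bilinear[OF d x']] bilinear_radd[OF metric_bilinear[OF d x']])
  qed
  have "g d x' (?A (\<Gamma> c x u v)) (?A w) = g d x' (S u v) (?A w)" for w
  proof -
    have "g d x' (?A (\<Gamma> c x u v)) (?A w) = g c x (\<Gamma> c x u v) w" using tr[OF xW] \<phi>x by simp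
    also have "\<dots> = koszul_form c x u v w"
      unfolding koszul_form_def by (rule koszul[OF levi_civita_sym[OF c x] levi_civita_metric[OF c x] c x])
    also have "\<dots> = g d x' (S u v) (?A w)"
      unfolding koszul_form_def k Ssym[of w u] Ssym[of w v] Ssym[of v u] metric_sym[OF d x', of "?A _" "S _ _"]
      by simp
    finally show ?thesis .
  qed
  then have "g d x' (?A (\<Gamma> c x u v)) w = g d x' (S u v) w" for w
    using surj by (metis surjD)
  then show ?thesis using metric_nondegenerate[OF d x'] S_def by metis
qed

end

context riemannian_surface
begin

section \<open>Covariant derivatives along maps into a chart\<close>

text \<open>The covariant derivative in direction \<open>v\<close> of a vector field \<open>Y\<close> along a map \<open>X\<close> from an open
  set of a Euclidean parameter space into the image of the chart \<open>c\<close>, in the coordinates of \<open>c\<close>.  For a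
  curve the parameter space is the line and \<open>v = 1\<close>; for a variation it is the plane, \<open>(1, 0)\<close>
  being the direction of the variation parameter and \<open>(0, 1)\<close> that of the curve parameter.\<close>

definition covd ::
  "('a, real^2) chart \<Rightarrow> ('p::euclidean_space \<Rightarrow> real^2) \<Rightarrow> 'p \<Rightarrow> ('p \<Rightarrow> real^2) \<Rightarrow> 'p \<Rightarrow> real^2"
  where
  "covd c X v Y p = \<partial> v Y p + \<Gamma> c (X p) (\<partial> v X p) (Y p)"

context
  fixes c and S :: "'p::euclidean_space set" and X :: "'p \<Rightarrow> real^2"
  assumes c: "c \<in> atlas N" and S: "open S" and X: "smooth_on S X" and XS: "X ` S \<subseteq> chart_im c"
begin

lemma smooth_on_covd:
  assumes Y: "smooth_on S Y"
  shows "smooth_on S (covd c X v Y)"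
proof -
  have "smooth_on S (\<lambda>p. \<Gamma> c (X p) (\<partial> v X p) (Y p))"
    by (rule smooth_on_bilinear_field[OF S chart_im_open[OF c] X smooth_on_dir_deriv[OF X] Y XS
          levi_civita_bilinear[OF c] smooth_on_levi_civita[OF c]])
  from smooth_on_add[OF S smooth_on_dir_deriv[OF Y] this] show ?thesis
    by (simp add: covd_def[abs_def])
qed

lemma covd_cong:
  assumes "smooth_on S Y" "\<And>p. p \<in> S \<Longrightarrow> Y p = Z p" "p \<in> S"
  shows "covd c X v Y p = covd c X v Z p"
  unfolding covd_def using dir_deriv_cong[OF S assms(3,2) smooth_on_differentiable[OF assms(1,3)]] assms by simp

lemma covd_add:
  assumes "smooth_on S Y" "smooth_on S Z" "p \<in> S"
  shows "covd c X v (\<lambda>p. Y p + Z p) p = covd c X v Y p + covd c X v Z p"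
proof -
  have "\<partial> v (\<lambda>p. Y p + Z p) p = \<partial> v Y p + \<partial> v Z p"
    by (rule dir_deriv_eqI, rule has_derivative_add) (use assms smooth_on_has_derivative in auto)
  then show ?thesis
    unfolding covd_def using bilinear_radd[OF levi_civita_bilinear[OF c]] XS assms(3) by (simp add: image_subset_iff)
qed

lemma covd_scaleR:
  assumes "smooth_on S Y" "p \<in> S"
  shows "covd c X v (\<lambda>p. r *\<^sub>R Y p) p = r *\<^sub>R covd c X v Y p"
proof -
  have "\<partial> v (\<lambda>p. r *\<^sub>R Y p) p = r *\<^sub>R \<partial> v Y p"
    by (rule dir_deriv_eqI, rule has_derivative_scaleR_right) (use assms smooth_on_has_derivative in auto)
  then show ?thesis
    unfolding covd_def using bilinear_rmul[OF levi_civita_bilinear[OF c]] XS assms(2)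
    by (simp add: image_subset_iff scaleR_right_distrib)
qed

lemma covd_torsion_free: "p \<in> S \<Longrightarrow> covd c X u (\<partial> v X) p = covd c X v (\<partial> u X) p"
  unfolding covd_def using dir_deriv_commute[OF S X] levi_civita_sym[OF c] XS by (simp add: image_subset_iff)

lemma dir_deriv_metric_along:
  assumes Y: "smooth_on S Y" and Z: "smooth_on S Z" and p: "p \<in> S"
  shows "\<partial> u (\<lambda>p. g c (X p) (Y p) (Z p)) p = g c (X p) (covd c X u Y p) (Z p) + g c (X p) (Y p) (covd c X u Z p)"
proof -
  have Xp: "X p \<in> chart_im c" using p XS by auto
  have "\<partial> u (\<lambda>p. g c (X p) (Y p) (Z p)) p
      = \<partial> (\<partial> u X p) (\<lambda>y. g c y (Y p) (Z p)) (X p) + g c (X p) (\<partial> u Y p) (Z p) + g c (X p) (Y p) (\<partial> u Z p)"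
    by (rule dir_deriv_eqI, rule has_derivative_bilinear_field[where x = X, OF chart_im_open[OF c] Xp])
       (use metric_bilinear[OF c] metric_smooth[OF c] smooth_on_has_derivative X Y Z p in auto)
  then show ?thesis
    unfolding covd_def levi_civita_metric[OF c Xp]
    by (simp add: bilinear_ladd[OF metric_bilinear[OF c Xp]] bilinear_radd[OF metric_bilinear[OF c Xp]])
qed

lemma covd_commutator:
  assumes Y: "smooth_on S Y" and p: "p \<in> S"
  shows "covd c X u (covd c X v Y) p = covd c X v (covd c X u Y) p
     + curvature N c (X p) (\<partial> u X p) (\<partial> v X p) (Y p)"
proof -
  have Xp: "X p \<in> chart_im c" using p XS by auto
  note b = bilinear_ladd[OF levi_civita_bilinear[OF c Xp]] bilinear_radd[OF levi_civita_bilinear[OF c Xp]]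
  have d: "\<partial> u (covd c X v Y) p = \<partial> u (\<partial> v Y) p + (\<partial> (\<partial> u X p) (\<lambda>y. \<Gamma> c y (\<partial> v X p) (Y p)) (X p)
      + \<Gamma> c (X p) (\<partial> u (\<partial> v X) p) (Y p) + \<Gamma> c (X p) (\<partial> v X p) (\<partial> u Y p))" for u v
    unfolding covd_def
    by (rule dir_deriv_eqI, rule has_derivative_add, rule smooth_on_has_derivative[OF smooth_on_dir_deriv[OF Y] p],
        rule has_derivative_bilinear_field[where x = X and B = "\<Gamma> c", OF chart_im_open[OF c] Xp
          levi_civita_bilinear[OF c] smooth_on_levi_civita[OF c] smooth_on_has_derivative[OF X p]
          smooth_on_has_derivative[OF smooth_on_dir_deriv[OF X] p] smooth_on_has_derivative[OF Y p]])
  show ?thesis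
    unfolding covd_def[of c X u "covd c X v Y"] covd_def[of c X v "covd c X u Y"] d
    unfolding covd_def b curvature_def dir_deriv_commute[OF S Y p, of u v] dir_deriv_commute[OF S X p, of u v]
    by (simp add: algebra_simps)
qed

end

lemma smooth_on_slice:
  assumes S: "open S" and Y: "smooth_on S Y" and J: "open J" and JS: "{r} \<times> J \<subseteq> S"
  shows "smooth_on J (\<lambda>t. Y (r, t))"
proof -
  have "smooth_on J (\<lambda>t. (r, 0) + (0, t))"
    by (intro smooth_on_add J smooth_on_const smooth_on_bounded_linear bounded_linear_Pair
        bounded_linear_zero bounded_linear_ident)
  then show ?thesis using smooth_on_compose[OF J S Y, of "\<lambda>t. (r, t)"] JS by auto
qed

text \<open>The covariant derivative in the curve direction involves only one curve of a variation.\<close>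

context
  fixes c and S :: "(real \<times> real) set" and X :: "real \<times> real \<Rightarrow> real^2"
    and r :: real and J :: "real set" and y :: "real \<Rightarrow> real^2"
  assumes c: "c \<in> atlas N" and S: "open S" and X: "smooth_on S X" and XS: "X ` S \<subseteq> chart_im c"
    and J: "open J" and JS: "{r} \<times> J \<subseteq> S" and yX: "\<And>t. t \<in> J \<Longrightarrow> X (r, t) = y t"
begin

lemma covd_slice:
  assumes Y: "smooth_on S Y" and YZ: "\<And>t. t \<in> J \<Longrightarrow> Y (r, t) = Z t" and t: "t \<in> J"
  shows "covd c X (0, 1) Y (r, t) = covd c y 1 Z t"
proof -
  have p: "(r, t) \<in> S" using t JS by auto
  have "\<partial> (0, 1) X (r, t) = \<partial> 1 y t"
    using dir_deriv_slice[OF smooth_on_differentiable[OF X p], of 1]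
      dir_deriv_cong[OF J t yX smooth_on_differentiable[OF smooth_on_slice[OF S X J JS] t], of 1] by simp
  moreover have "\<partial> (0, 1) Y (r, t) = \<partial> 1 Z t"
    using dir_deriv_slice[OF smooth_on_differentiable[OF Y p], of 1]
      dir_deriv_cong[OF J t YZ smooth_on_differentiable[OF smooth_on_slice[OF S Y J JS] t], of 1] by simp
  ultimately show ?thesis by (simp only: covd_def yX[OF t] YZ[OF t])
qed

lemma iterated_covd_slice:
  "smooth_on S ((covd c X (0, 1) ^^ j) (\<partial> (0, 1) X))"
  "t \<in> J \<Longrightarrow> (covd c X (0, 1) ^^ j) (\<partial> (0, 1) X) (r, t) = (covd c y 1 ^^ j) (\<partial> 1 y) t"
proof (induction j arbitrary: t)
  case 0
  { case 1 show ?case using smooth_on_dir_deriv[OF X] by simp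
  next case 2
    have "(r, t) \<in> S" using 2 JS by auto
    then show ?case
      using dir_deriv_slice[OF smooth_on_differentiable[OF X], of r t 1]
        dir_deriv_cong[OF J 2 yX smooth_on_differentiable[OF smooth_on_slice[OF S X J JS] 2], of 1] by simp }
next
  case (Suc j)
  { case 1 show ?case using smooth_on_covd[OF c S X XS Suc(1)] by simp
  next case 2 show ?case
      unfolding funpow.simps o_apply by (rule covd_slice[OF Suc(1) Suc(2) 2]) }
qed

end

section \<open>Curves in the manifold and their coordinate expressions\<close>

lemma velocity_transition:
  assumes c: "c \<in> atlas N" and d: "d \<in> atlas N" and A: "open A" "t \<in> A" "\<beta> ` A \<subseteq> chart_dom c \<inter> chart_dom d"
    and y: "(\<lambda>r. coord c (\<beta> r)) differentiable (at t)"
  shows "velocity \<beta> t d = \<partial> (velocity \<beta> t c) (transition c d) (coord c (\<beta> t))"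
proof -
  have \<phi>: "transition c d differentiable (at (coord c (\<beta> t)))"
    by (rule smooth_on_differentiable[OF transition_smooth[OF c d]]) (use A in auto)
  have D: "((\<lambda>r. transition c d (coord c (\<beta> r))) has_derivative
      (\<lambda>h. \<partial> (\<partial> h (\<lambda>r. coord c (\<beta> r)) t) (transition c d) (coord c (\<beta> t)))) (at t)"
    by (rule has_derivative_compose[OF has_derivative_dir_deriv[OF y] has_derivative_dir_deriv[OF \<phi>]])
  have "((\<lambda>r. coord d (\<beta> r)) has_derivative
      (\<lambda>h. \<partial> (\<partial> h (\<lambda>r. coord c (\<beta> r)) t) (transition c d) (coord c (\<beta> t)))) (at t)"
    by (rule has_derivative_transform_within_open[OF D A(1,2)], rule transition_coord[OF c]) (use A(3) in blast)
  then show ?thesis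
    unfolding velocity_def
    by (simp add: vector_derivative_eq_dir_deriv y differentiableI dir_deriv_eqI)
qed

lemma cov_deriv_transition:
  assumes c: "c \<in> atlas N" and d: "d \<in> atlas N" and A: "open A" "t \<in> A" "\<beta> ` A \<subseteq> chart_dom c \<inter> chart_dom d"
    and y: "(\<lambda>r. coord c (\<beta> r)) differentiable (at t)"
    and V: "\<And>r. r \<in> A \<Longrightarrow> V r d = \<partial> (V r c) (transition c d) (coord c (\<beta> r))"
    and dV: "(\<lambda>r. V r c) differentiable (at t)"
  shows "cov_deriv N \<beta> V t d = \<partial> (cov_deriv N \<beta> V t c) (transition c d) (coord c (\<beta> t))"
proof -
  define W where "W = coord c ` (chart_dom c \<inter> chart_dom d)"
  define \<phi> where "\<phi> = transition c d"
  define x where "x = coord c (\<beta> t)"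
  have W: "open W" unfolding W_def
    using open_coord_image[OF c openin_Int[OF chart_dom_open[OF c] chart_dom_open[OF d]]] by auto
  have \<phi>: "smooth_on W \<phi>" unfolding W_def \<phi>_def by (rule transition_smooth[OF c d])
  have p: "\<beta> t \<in> chart_dom c \<inter> chart_dom d" using A by auto
  have xW: "x \<in> W" using p by (auto simp: W_def x_def)
  have lin: "linear (\<lambda>u. \<partial> u \<phi> y)" if "y \<in> W" for y
    by (rule linear_dir_deriv[OF smooth_on_differentiable[OF \<phi> that]])
  have D: "((\<lambda>r. \<partial> (V r c) \<phi> (coord c (\<beta> r))) has_derivative
     (\<lambda>h. \<partial> (\<partial> h (\<lambda>r. coord c (\<beta> r)) t) (\<partial> (V t c) \<phi>) x + \<partial> (\<partial> h (\<lambda>r. V r c) t) \<phi> x)) (at t)"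
    unfolding x_def
    by (rule has_derivative_linear_field[where B = "\<lambda>y u. \<partial> u \<phi> y", OF W _ lin smooth_on_dir_deriv[OF \<phi>]
          has_derivative_dir_deriv[OF y] has_derivative_dir_deriv[OF dV]])
       (use xW x_def in auto)
  have "((\<lambda>r. V r d) has_derivative
     (\<lambda>h. \<partial> (\<partial> h (\<lambda>r. coord c (\<beta> r)) t) (\<partial> (V t c) \<phi>) x + \<partial> (\<partial> h (\<lambda>r. V r c) t) \<phi> x)) (at t)"
    by (rule has_derivative_transform_within_open[OF D A(1,2)]) (use V \<phi>_def in auto)
  then have "vector_derivative (\<lambda>r. V r d) (at t)
      = \<partial> (velocity \<beta> t c) (\<partial> (V t c) \<phi>) x + \<partial> (vector_derivative (\<lambda>r. V r c) (at t)) \<phi> x"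
    unfolding velocity_def
    by (simp add: vector_derivative_eq_dir_deriv y dV differentiableI dir_deriv_eqI)
  moreover have "\<partial> (\<Gamma> c x (velocity \<beta> t c) (V t c)) \<phi> x
     = \<Gamma> d (coord d (\<beta> t)) (velocity \<beta> t d) (V t d) + \<partial> (velocity \<beta> t c) (\<partial> (V t c) \<phi>) x"
    using levi_civita_transition[OF c d p] velocity_transition[OF c d A y] V[OF A(2)]
    unfolding x_def \<phi>_def by simp
  ultimately show ?thesis
    unfolding cov_deriv_def using linear_add[OF lin[OF xW]] by (simp add: x_def \<phi>_def)
qed

text \<open>The inner product is computed in a chart chosen separately at every point; for vectors that obey the
  transformation law, any chart gives the same value.\<close>

lemma riem_inner_in_chart:
  assumes c: "c \<in> atlas N" "p \<in> chart_dom c"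
    and u: "\<And>d. d \<in> atlas N \<Longrightarrow> p \<in> chart_dom d \<Longrightarrow> u d = \<partial> (u c) (transition c d) (coord c p)"
    and v: "\<And>d. d \<in> atlas N \<Longrightarrow> p \<in> chart_dom d \<Longrightarrow> v d = \<partial> (v c) (transition c d) (coord c p)"
  shows "riem_inner N p u v = g c (coord c p) (u c) (v c)"
proof -
  define d where "d = (SOME c. c \<in> atlas N \<and> p \<in> chart_dom c)"
  have d: "d \<in> atlas N \<and> p \<in> chart_dom d" unfolding d_def by (rule someI) (use c in blast)
  show ?thesis
    unfolding riem_inner_def Let_def d_def[symmetric]
    using metric_transition[OF c(1), of d p "u c" "v c"] c(2) d u v by simp
qed

context
  fixes c and J :: "real set" and \<beta> :: "real \<Rightarrow> 'a"
  assumes c: "c \<in> atlas N" and J: "open J" and \<beta>J: "\<beta> ` J \<subseteq> chart_dom c"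
    and y: "smooth_on J (\<lambda>t. coord c (\<beta> t))"
    and op: "\<And>d. d \<in> atlas N \<Longrightarrow> open (J \<inter> \<beta> -` chart_dom d)"
begin

lemma velocity_in_chart: "t \<in> J \<Longrightarrow> velocity \<beta> t c = \<partial> 1 (\<lambda>t. coord c (\<beta> t)) t"
  unfolding velocity_def using smooth_on_differentiable[OF y] vector_derivative_eq_dir_deriv by blast

lemma cov_deriv_in_chart:
  assumes "smooth_on J (\<lambda>t. V t c)" "t \<in> J"
  shows "cov_deriv N \<beta> V t c = covd c (\<lambda>t. coord c (\<beta> t)) 1 (\<lambda>t. V t c) t"
  unfolding cov_deriv_def covd_def velocity_in_chart[OF assms(2)]
  using vector_derivative_eq_dir_deriv[OF smooth_on_differentiable[OF assms]] by simp

text \<open>As long as the curve stays in the domain of \<open>c\<close>, the components in \<open>c\<close> of the covariant derivatives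
  of its velocity depend only on its coordinate expression.\<close>

lemma iterated_cov_deriv_in_chart:
  "smooth_on J (\<lambda>t. (cov_deriv N \<beta> ^^ j) (velocity \<beta>) t c)"
  "t \<in> J \<Longrightarrow> (cov_deriv N \<beta> ^^ j) (velocity \<beta>) t c
      = (covd c (\<lambda>t. coord c (\<beta> t)) 1 ^^ j) (\<partial> 1 (\<lambda>t. coord c (\<beta> t))) t"
proof (induction j arbitrary: t)
  case 0
  { case 1 show ?case by (rule smooth_on_cong[OF J smooth_on_dir_deriv[OF y]]) (simp add: velocity_in_chart)
  next case 2 then show ?case by (simp add: velocity_in_chart) }
next
  case (Suc j)
  have yJ: "(\<lambda>t. coord c (\<beta> t)) ` J \<subseteq> chart_im c" using \<beta>J by auto
  have eq: "(cov_deriv N \<beta> ^^ Suc j) (velocity \<beta>) t c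
      = covd c (\<lambda>t. coord c (\<beta> t)) 1 (\<lambda>t. (cov_deriv N \<beta> ^^ j) (velocity \<beta>) t c) t" if "t \<in> J" for t
    using cov_deriv_in_chart[where V = "(cov_deriv N \<beta> ^^ j) (velocity \<beta>)", OF Suc(1) that] by simp
  have sm: "smooth_on J (covd c (\<lambda>t. coord c (\<beta> t)) 1 (\<lambda>t. (cov_deriv N \<beta> ^^ j) (velocity \<beta>) t c))"
    by (rule smooth_on_covd[OF c J y yJ Suc(1)])
  { case 1 show ?case by (rule smooth_on_cong[OF J sm]) (simp only: eq)
  next case 2 show ?case
      unfolding funpow.simps o_apply
        cov_deriv_in_chart[where V = "(cov_deriv N \<beta> ^^ j) (velocity \<beta>)", OF Suc(1) 2]
      by (rule covd_cong[OF c J y yJ Suc(1) Suc(2) 2]) }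
qed

text \<open>So the covariant derivatives of the velocity are tangent vectors.\<close>

lemma iterated_cov_deriv_tangent:
  assumes "t \<in> J" "d \<in> atlas N" "\<beta> t \<in> chart_dom d"
  shows "(cov_deriv N \<beta> ^^ j) (velocity \<beta>) t d
     = \<partial> ((cov_deriv N \<beta> ^^ j) (velocity \<beta>) t c) (transition c d) (coord c (\<beta> t))"
  using assms(1,3)
proof (induction j arbitrary: t)
  case 0
  have sub: "\<beta> ` (J \<inter> \<beta> -` chart_dom d) \<subseteq> chart_dom c \<inter> chart_dom d" using \<beta>J by blast
  show ?case
    using velocity_transition[OF c assms(2) op[OF assms(2)] _ sub smooth_on_differentiable[OF y 0(1)]] 0
    by simp
next
  case (Suc j)
  have sub: "\<beta> ` (J \<inter> \<beta> -` chart_dom d) \<subseteq> chart_dom c \<inter> chart_dom d" using \<beta>J by blast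
  have t: "t \<in> J \<inter> \<beta> -` chart_dom d" using Suc.prems by simp
  have "cov_deriv N \<beta> ((cov_deriv N \<beta> ^^ j) (velocity \<beta>)) t d
     = \<partial> (cov_deriv N \<beta> ((cov_deriv N \<beta> ^^ j) (velocity \<beta>)) t c) (transition c d) (coord c (\<beta> t))"
    by (rule cov_deriv_transition[where V = "(cov_deriv N \<beta> ^^ j) (velocity \<beta>)", OF c assms(2) op[OF assms(2)] t sub smooth_on_differentiable[OF y Suc.prems(1)]
          _ smooth_on_differentiable[OF iterated_cov_deriv_in_chart(1) Suc.prems(1)]])
       (simp add: Suc.IH)
  then show ?case by simp
qed

lemma energy_density_in_chart:
  assumes "t \<in> J"
  shows "riem_inner N (\<beta> t) ((cov_deriv N \<beta> ^^ j) (velocity \<beta>) t) ((cov_deriv N \<beta> ^^ j) (velocity \<beta>) t)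
     = (let Y = (covd c (\<lambda>t. coord c (\<beta> t)) 1 ^^ j) (\<partial> 1 (\<lambda>t. coord c (\<beta> t))) t
        in g c (coord c (\<beta> t)) Y Y)"
  unfolding Let_def iterated_cov_deriv_in_chart(2)[OF assms, symmetric]
  by (rule riem_inner_in_chart[OF c _ iterated_cov_deriv_tangent[OF assms] iterated_cov_deriv_tangent[OF assms]])
     (use \<beta>J assms in blast)

end

end

section \<open>The first variation of the energy\<close>

context riemannian_surface
begin

text \<open>The \<open>j\<close>-th covariant derivative of the velocities of the curves of the variation \<open>X\<close>.\<close>

definition tangent_deriv :: "('a, real^2) chart \<Rightarrow> (real \<times> real \<Rightarrow> real^2) \<Rightarrow> nat \<Rightarrow> real \<times> real \<Rightarrow> real^2" where
  "tangent_deriv c X j = (covd c X (0, 1) ^^ j) (\<partial> (0, 1) X)"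

text \<open>Its covariant derivative in the direction of the variation parameter, along the initial curve.\<close>

definition variation :: "('a, real^2) chart \<Rightarrow> (real \<times> real \<Rightarrow> real^2) \<Rightarrow> nat \<Rightarrow> real \<Rightarrow> real^2" where
  "variation c X j t = covd c X (1, 0) (tangent_deriv c X j) (0, t)"

text \<open>Twice the integrand of the energy of order \<open>j + 1\<close>.\<close>

definition energy_density ::
  "('a, real^2) chart \<Rightarrow> (real \<times> real \<Rightarrow> real^2) \<Rightarrow> nat \<Rightarrow> real \<times> real \<Rightarrow> real" where
  "energy_density c X j p = g c (X p) (tangent_deriv c X j p) (tangent_deriv c X j p)"

text \<open>A unit speed curve \<open>x\<close> with unit normal \<open>\<nu>\<close> and constant geodesic curvature \<open>k\<close>, in coordinates.\<close>

context
  fixes c :: "('a, real^2) chart" and J :: "real set" and x :: "real \<Rightarrow> real^2" and \<nu> :: "real \<Rightarrow> real^2"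
    and k a b :: real
  assumes c: "c \<in> atlas N" and J: "open J" and x: "smooth_on J x" and xJ: "x ` J \<subseteq> chart_im c"
    and \<nu>: "smooth_on J \<nu>"
    and nabT: "\<And>t. t \<in> J \<Longrightarrow> covd c x 1 (\<partial> 1 x) t = k *\<^sub>R \<nu> t"
    and nab\<nu>: "\<And>t. t \<in> J \<Longrightarrow> covd c x 1 \<nu> t = (- k) *\<^sub>R \<partial> 1 x t"
    and TT: "\<And>t. t \<in> J \<Longrightarrow> g c (x t) (\<partial> 1 x t) (\<partial> 1 x t) = 1"
    and \<nu>\<nu>: "\<And>t. t \<in> J \<Longrightarrow> g c (x t) (\<nu> t) (\<nu> t) = 1"
    and \<nu>T: "\<And>t. t \<in> J \<Longrightarrow> g c (x t) (\<nu> t) (\<partial> 1 x t) = 0"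
    and ab: "a \<le> b" "{a..b} \<subseteq> J"
begin

lemma T_smooth: "smooth_on J (\<partial> 1 x)"
  by (rule smooth_on_dir_deriv[OF x])

lemmas covd_curve = smooth_on_covd[OF c J x xJ] covd_cong[OF c J x xJ] covd_add[OF c J x xJ] covd_scaleR[OF c J x xJ]

lemma metric_bilinear_along: "t \<in> J \<Longrightarrow> bilinear (g c (x t))"
  using metric_bilinear[OF c] xJ by blast

lemma smooth_on_metric_along:
  "smooth_on J Y \<Longrightarrow> smooth_on J Z \<Longrightarrow> smooth_on J (\<lambda>t. g c (x t) (Y t) (Z t))"
  by (rule smooth_on_bilinear_field[OF J chart_im_open[OF c] x _ _ xJ metric_bilinear[OF c] metric_smooth[OF c]])

lemma integrable_metric_along:
  "smooth_on J Y \<Longrightarrow> smooth_on J Z \<Longrightarrow> (\<lambda>t. g c (x t) (Y t) (Z t)) integrable_on {a..b}"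
  using integrable_continuous_interval[OF continuous_on_subset[OF smooth_on_continuous[OF smooth_on_metric_along] ab(2)]] .

text \<open>When the frame (tangent, normal) is identified with \<open>(1, \<i>)\<close>, covariant differentiation of
  combinations with constant coefficients is multiplication by \<open>\<i> k\<close>.\<close>

lemma iterated_covd_tangent:
  "smooth_on J ((covd c x 1 ^^ j) (\<partial> 1 x))"
  "t \<in> J \<Longrightarrow> (covd c x 1 ^^ j) (\<partial> 1 x) t
      = Re ((\<i> * complex_of_real k) ^ j) *\<^sub>R \<partial> 1 x t + Im ((\<i> * complex_of_real k) ^ j) *\<^sub>R \<nu> t"
proof (induction j arbitrary: t)
  case 0
  { case 1 show ?case using T_smooth by simp
  next case 2 show ?case by simp }
next
  case (Suc j)
  let ?p = "Re ((\<i> * complex_of_real k) ^ j)" and ?q = "Im ((\<i> * complex_of_real k) ^ j)"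
  { case 1 show ?case using covd_curve(1)[OF Suc(1)] by simp
  next case 2
    have "(covd c x 1 ^^ Suc j) (\<partial> 1 x) t = covd c x 1 (\<lambda>t. ?p *\<^sub>R \<partial> 1 x t + ?q *\<^sub>R \<nu> t) t"
      unfolding funpow.simps o_apply by (rule covd_curve(2)[OF Suc(1) Suc(2) 2])
    also have "\<dots> = ?p *\<^sub>R covd c x 1 (\<partial> 1 x) t + ?q *\<^sub>R covd c x 1 \<nu> t"
      using covd_curve(3)[OF smooth_on_scaleR[OF J smooth_on_const T_smooth] smooth_on_scaleR[OF J smooth_on_const \<nu>] 2]
        covd_curve(4)[OF T_smooth 2] covd_curve(4)[OF \<nu> 2] by simp
    finally show ?case by (simp add: nabT[OF 2] nab\<nu>[OF 2] mult.commute) }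
qed

text \<open>Integration by parts against the frame.\<close>

lemma integral_covd_frame:
  assumes Y: "smooth_on J Y" and Y0: "Y a = 0" "Y b = 0"
  shows "integral {a..b} (\<lambda>t. g c (x t) (covd c x 1 Y t) (\<partial> 1 x t)) = - k * integral {a..b} (\<lambda>t. g c (x t) (Y t) (\<nu> t))"
    and "integral {a..b} (\<lambda>t. g c (x t) (covd c x 1 Y t) (\<nu> t)) = k * integral {a..b} (\<lambda>t. g c (x t) (Y t) (\<partial> 1 x t))"
proof -
  have abJ: "a \<in> J" "b \<in> J" using ab by auto
  have parts: "integral {a..b} (\<lambda>t. g c (x t) (covd c x 1 Y t) (Z t))
      = - integral {a..b} (\<lambda>t. g c (x t) (Y t) (covd c x 1 Z t))" if Z: "smooth_on J Z" for Z
  proof -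
    let ?h = "\<lambda>t. g c (x t) (Y t) (Z t)"
    have "(\<partial> 1 ?h has_integral ?h b - ?h a) {a..b}"
      by (rule fundamental_theorem_of_calculus[OF ab(1)], rule has_vector_derivative_at_within,
          rule has_vector_derivative_dir_deriv, rule smooth_on_differentiable[OF smooth_on_metric_along[OF Y Z]])
         (use ab in auto)
    then have "integral {a..b} (\<partial> 1 ?h) = 0"
      using Y0 bilinear_lzero[OF metric_bilinear_along[OF abJ(1)]] bilinear_lzero[OF metric_bilinear_along[OF abJ(2)]]
      by (simp add: integral_unique)
    moreover have "integral {a..b} (\<partial> 1 ?h) = integral {a..b}
        (\<lambda>t. g c (x t) (covd c x 1 Y t) (Z t) + g c (x t) (Y t) (covd c x 1 Z t))"
      by (rule integral_cong, rule dir_deriv_metric_along[OF c J x xJ Y Z]) (use ab in auto)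
    ultimately show ?thesis
      using integral_add[OF integrable_metric_along[OF covd_curve(1)[OF Y] Z]
          integrable_metric_along[OF Y covd_curve(1)[OF Z]]] by simp
  qed
  have "integral {a..b} (\<lambda>t. g c (x t) (Y t) (covd c x 1 (\<partial> 1 x) t)) = integral {a..b} (\<lambda>t. k * g c (x t) (Y t) (\<nu> t))"
    by (rule integral_cong) (use ab in \<open>auto simp: nabT bilinear_rmul[OF metric_bilinear_along]\<close>)
  then show "integral {a..b} (\<lambda>t. g c (x t) (covd c x 1 Y t) (\<partial> 1 x t)) = - k * integral {a..b} (\<lambda>t. g c (x t) (Y t) (\<nu> t))"
    using parts[OF T_smooth] by simp
  have "integral {a..b} (\<lambda>t. g c (x t) (Y t) (covd c x 1 \<nu> t)) = integral {a..b} (\<lambda>t. (- k) * g c (x t) (Y t) (\<partial> 1 x t))"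
    by (rule integral_cong) (use ab in \<open>simp only: nab\<nu> bilinear_rmul[OF metric_bilinear_along] subset_iff real_scaleR_def\<close>)
  then show "integral {a..b} (\<lambda>t. g c (x t) (covd c x 1 Y t) (\<nu> t)) = k * integral {a..b} (\<lambda>t. g c (x t) (Y t) (\<partial> 1 x t))"
    using parts[OF \<nu>] by simp
qed

text \<open>A variation of the curve with variation field \<open>f \<nu>\<close>, where \<open>f\<close> is supported in the interior of
  \<open>{a..b}\<close>.\<close>

context
  fixes X :: "real \<times> real \<Rightarrow> real^2" and e a' b' K :: real and f :: "real \<Rightarrow> real"
  assumes e: "e > 0" and X: "smooth_on ({-e<..<e} \<times> J) X" and XS: "X ` ({-e<..<e} \<times> J) \<subseteq> chart_im c"
    and X0: "\<And>t. t \<in> J \<Longrightarrow> X (0, t) = x t"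
    and X1: "\<And>t. t \<in> J \<Longrightarrow> \<partial> (1, 0) X (0, t) = f t *\<^sub>R \<nu> t"
    and f: "smooth_on UNIV f" and f0: "\<And>t. t \<notin> {a'..b'} \<Longrightarrow> f t = 0" and ab': "a < a'" "b' < b"
    and K: "constant_sectional_curvature N K"
begin

lemma strip_open: "open ({-e<..<e} \<times> J)"
  by (intro open_Times J open_greaterThanLessThan)

lemma strip_0: "t \<in> J \<Longrightarrow> (0, t) \<in> {-e<..<e} \<times> J"
  using e by simp

lemma strip_slice: "{0} \<times> J \<subseteq> {-e<..<e} \<times> J"
  using e by auto

lemma covd_slice_0:
  assumes "smooth_on ({-e<..<e} \<times> J) Y" "\<And>t. t \<in> J \<Longrightarrow> Y (0, t) = Z t" "t \<in> J"
  shows "covd c X (0, 1) Y (0, t) = covd c x 1 Z t"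
  by (rule covd_slice[OF c strip_open X XS J strip_slice X0]) (use assms in auto)

lemma tangent_deriv_smooth: "smooth_on ({-e<..<e} \<times> J) (tangent_deriv c X j)"
  unfolding tangent_deriv_def by (rule iterated_covd_slice(1)[OF c strip_open X XS J strip_slice X0])

lemma tangent_deriv_0: "t \<in> J \<Longrightarrow> tangent_deriv c X j (0, t) = (covd c x 1 ^^ j) (\<partial> 1 x) t"
  unfolding tangent_deriv_def by (rule iterated_covd_slice(2)[OF c strip_open X XS J strip_slice X0])

lemma variation_smooth: "smooth_on J (variation c X j)"
  using smooth_on_slice[OF strip_open smooth_on_covd[OF c strip_open X XS tangent_deriv_smooth] J strip_slice] unfolding variation_def[abs_def] .

lemma smooth_on_f\<nu>: "smooth_on J (\<lambda>t. f t *\<^sub>R \<nu> t)"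
  by (intro smooth_on_scaleR J \<nu> smooth_on_subset[OF f]) simp

lemma variation_first:
  assumes t: "t \<in> J"
  shows "variation c X 0 t = covd c x 1 (\<lambda>t. f t *\<^sub>R \<nu> t) t"
proof -
  have "variation c X 0 t = covd c X (0, 1) (\<partial> (1, 0) X) (0, t)"
    using covd_torsion_free[OF c strip_open X XS strip_0[OF t]] by (simp add: variation_def tangent_deriv_def)
  also have "\<dots> = covd c x 1 (\<lambda>t. f t *\<^sub>R \<nu> t) t"
    by (rule covd_slice_0[OF smooth_on_dir_deriv[OF X] X1 t])
  finally show ?thesis .
qed

text \<open>Exchanging the two covariant derivatives produces the curvature term.\<close>

lemma variation_Suc:
  assumes t: "t \<in> J"
  shows "variation c X (Suc j) t = covd c x 1 (variation c X j) t + f t *\<^sub>R curvature N c (x t) (\<nu> t) (\<partial> 1 x t) (tangent_deriv c X j (0, t))"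
proof -
  have "variation c X (Suc j) t = covd c X (0, 1) (covd c X (1, 0) (tangent_deriv c X j)) (0, t)
     + curvature N c (X (0, t)) (\<partial> (1, 0) X (0, t)) (\<partial> (0, 1) X (0, t)) (tangent_deriv c X j (0, t))"
    using covd_commutator[OF c strip_open X XS tangent_deriv_smooth strip_0[OF t], of "(1, 0)" "(0, 1)" j]
    unfolding variation_def tangent_deriv_def by simp
  moreover have "covd c X (0, 1) (covd c X (1, 0) (tangent_deriv c X j)) (0, t) = covd c x 1 (variation c X j) t"
    by (rule covd_slice_0[OF smooth_on_covd[OF c strip_open X XS tangent_deriv_smooth] _ t]) (simp add: variation_def)
  moreover have "\<partial> (0, 1) X (0, t) = \<partial> 1 x t" using tangent_deriv_0[OF t, of 0] by (simp add: tangent_deriv_def)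
  moreover have "x t \<in> chart_im c" using xJ t by blast
  ultimately show ?thesis using X0[OF t] X1[OF t] curvature_linear(1)[OF c] by simp
qed

lemma variation_outside: "t \<in> J \<Longrightarrow> t \<notin> {a'..b'} \<Longrightarrow> variation c X j t = 0"
proof (induction j arbitrary: t)
  have A: "open (J - {a'..b'})" using J by (intro open_Diff closed_atLeastAtMost)
  have zero: "covd c x 1 Y t = 0" if t: "t \<in> J" "t \<notin> {a'..b'}" and Y: "\<And>t. t \<in> J \<Longrightarrow> t \<notin> {a'..b'} \<Longrightarrow> Y t = 0" for Y t
  proof -
    have "\<partial> 1 Y t = \<partial> 1 (\<lambda>t. 0) t"
      by (rule dir_deriv_cong[OF A, symmetric]) (use t Y in auto)
    moreover have "x t \<in> chart_im c" using xJ t by blast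
    ultimately show ?thesis
      unfolding covd_def using Y[OF t] bilinear_rzero[OF levi_civita_bilinear[OF c]] by simp
  qed
  case 0
  show ?case unfolding variation_first[OF 0(1)] by (rule zero[OF 0]) (simp add: f0)
next
  case (Suc j)
  have A: "open (J - {a'..b'})" using J by (intro open_Diff closed_atLeastAtMost)
  have "\<partial> 1 (variation c X j) t = \<partial> 1 (\<lambda>t. 0) t"
    by (rule dir_deriv_cong[OF A, symmetric]) (use Suc in auto)
  moreover have "x t \<in> chart_im c" using xJ Suc by blast
  ultimately have "covd c x 1 (variation c X j) t = 0"
    unfolding covd_def using Suc bilinear_rzero[OF levi_civita_bilinear[OF c]] by simp
  then show ?case using variation_Suc Suc.prems f0 by simp
qed

text \<open>Write \<open>m\<close> for the integral of \<open>f\<close> and \<open>W j\<close> for the integral of the components of \<open>variation j\<close> in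
  the frame, as a complex number.  Integration by parts and the value of the curvature turn the
  recursion for the variations into \<open>W 0 = - k m\<close> and \<open>W (Suc j) = \<i> k W j + \<i> K (\<i> k) ^ j m\<close>, which is
  solved by \<open>k W j = (\<i> k) ^ j (j K - k\<^sup>2) m\<close>.\<close>

lemma integral_variation:
  "k * integral {a..b} (\<lambda>t. g c (x t) (variation c X j t) (\<partial> 1 x t))
     = Re ((\<i> * complex_of_real k) ^ j) * integral {a..b} f * (real j * K - k\<^sup>2)"
  "k * integral {a..b} (\<lambda>t. g c (x t) (variation c X j t) (\<nu> t))
     = Im ((\<i> * complex_of_real k) ^ j) * integral {a..b} f * (real j * K - k\<^sup>2)"
proof (induction j)
  have out: "a \<in> J" "b \<in> J" "a \<notin> {a'..b'}" "b \<notin> {a'..b'}" using ab ab' by auto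
  case 0
  have "f a *\<^sub>R \<nu> a = 0" "f b *\<^sub>R \<nu> b = 0" using f0 out by simp_all
  note p = integral_covd_frame[OF smooth_on_f\<nu> this]
  have first: "integral {a..b} (\<lambda>t. g c (x t) (variation c X 0 t) (Z t))
     = integral {a..b} (\<lambda>t. g c (x t) (covd c x 1 (\<lambda>t. f t *\<^sub>R \<nu> t) t) (Z t))" for Z
    by (rule integral_cong) (use ab variation_first in auto)
  have "integral {a..b} (\<lambda>t. g c (x t) (f t *\<^sub>R \<nu> t) (\<nu> t)) = integral {a..b} f"
    by (rule integral_cong) (use ab in \<open>auto simp: bilinear_lmul[OF metric_bilinear_along] \<nu>\<nu> subset_iff\<close>)
  moreover have "integral {a..b} (\<lambda>t. g c (x t) (f t *\<^sub>R \<nu> t) (\<partial> 1 x t)) = integral {a..b} (\<lambda>t. 0)"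
    by (rule integral_cong) (use ab in \<open>auto simp: bilinear_lmul[OF metric_bilinear_along] \<nu>T subset_iff\<close>)
  ultimately have i: "integral {a..b} (\<lambda>t. g c (x t) (variation c X 0 t) (\<partial> 1 x t)) = - k * integral {a..b} f"
    "integral {a..b} (\<lambda>t. g c (x t) (variation c X 0 t) (\<nu> t)) = 0"
    unfolding first p by simp_all
  { case 1 show ?case unfolding i by (simp add: power2_eq_square)
  next case 2 show ?case unfolding i by simp }
next
  have out: "a \<in> J" "b \<in> J" "a \<notin> {a'..b'}" "b \<notin> {a'..b'}" using ab ab' by auto
  case (Suc j)
  let ?p = "Re ((\<i> * complex_of_real k) ^ j)" and ?q = "Im ((\<i> * complex_of_real k) ^ j)"
  note p = integral_covd_frame[OF variation_smooth[of j] variation_outside[OF out(1,3)] variation_outside[OF out(2,4)]]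
  have fint: "f integrable_on {a..b}"
    by (rule integrable_continuous_interval[OF continuous_on_subset[OF smooth_on_continuous[OF f]]]) simp
  have V: "tangent_deriv c X j (0, t) = ?p *\<^sub>R \<partial> 1 x t + ?q *\<^sub>R \<nu> t" if "t \<in> J" for t
    unfolding tangent_deriv_0[OF that] by (rule iterated_covd_tangent(2)[OF that])
  have R: "g c (x t) (curvature N c (x t) (\<nu> t) (\<partial> 1 x t) (tangent_deriv c X j (0, t))) (\<partial> 1 x t) = - K * ?q"
    "g c (x t) (curvature N c (x t) (\<nu> t) (\<partial> 1 x t) (tangent_deriv c X j (0, t))) (\<nu> t) = K * ?p" if t: "t \<in> J" for t
  proof -
    have xt: "x t \<in> chart_im c" using xJ t by blast
    note b = bilinear_ladd[OF metric_bilinear[OF c xt]] bilinear_lmul[OF metric_bilinear[OF c xt]]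
    note o = curvature_orthonormal[OF c K xt TT[OF t] \<nu>\<nu>[OF t] \<nu>T[OF t]]
    show "g c (x t) (curvature N c (x t) (\<nu> t) (\<partial> 1 x t) (tangent_deriv c X j (0, t))) (\<partial> 1 x t) = - K * ?q"
      "g c (x t) (curvature N c (x t) (\<nu> t) (\<partial> 1 x t) (tangent_deriv c X j (0, t))) (\<nu> t) = K * ?p"
      unfolding V[OF t] curvature_linear(2,3)[OF c xt] b o by simp_all
  qed
  have rec: "integral {a..b} (\<lambda>t. g c (x t) (variation c X (Suc j) t) (Z t))
      = integral {a..b} (\<lambda>t. g c (x t) (covd c x 1 (variation c X j) t) (Z t)) + C * integral {a..b} f"
    if Z: "smooth_on J Z"
      and C: "\<And>t. t \<in> J \<Longrightarrow> g c (x t) (curvature N c (x t) (\<nu> t) (\<partial> 1 x t) (tangent_deriv c X j (0, t))) (Z t) = C" for Z C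
  proof -
    have "integral {a..b} (\<lambda>t. g c (x t) (variation c X (Suc j) t) (Z t))
      = integral {a..b} (\<lambda>t. g c (x t) (covd c x 1 (variation c X j) t) (Z t) + C * f t)"
    proof (rule integral_cong)
      fix t assume "t \<in> {a..b}"
      then have t: "t \<in> J" using ab by auto
      show "g c (x t) (variation c X (Suc j) t) (Z t) = g c (x t) (covd c x 1 (variation c X j) t) (Z t) + C * f t"
        unfolding variation_Suc[OF t] by (simp add: bilinear_ladd[OF metric_bilinear_along[OF t]]
            bilinear_lmul[OF metric_bilinear_along[OF t]] C[OF t])
    qed
    also have "\<dots> = integral {a..b} (\<lambda>t. g c (x t) (covd c x 1 (variation c X j) t) (Z t)) + integral {a..b} (\<lambda>t. C * f t)"
      by (rule integral_add[OF integrable_metric_along[OF covd_curve(1)[OF variation_smooth] Z]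
            integrable_on_mult_right[OF fint]])
    finally show ?thesis by simp
  qed
  have recs: "integral {a..b} (\<lambda>t. g c (x t) (variation c X (Suc j) t) (\<partial> 1 x t))
      = - k * integral {a..b} (\<lambda>t. g c (x t) (variation c X j t) (\<nu> t)) + (- K * ?q) * integral {a..b} f"
    "integral {a..b} (\<lambda>t. g c (x t) (variation c X (Suc j) t) (\<nu> t))
      = k * integral {a..b} (\<lambda>t. g c (x t) (variation c X j t) (\<partial> 1 x t)) + (K * ?p) * integral {a..b} f"
    using rec[of "\<partial> 1 x", OF T_smooth R(1)] rec[of \<nu>, OF \<nu> R(2)] p by simp_all
  { case 1
    have "k * integral {a..b} (\<lambda>t. g c (x t) (variation c X (Suc j) t) (\<partial> 1 x t))
        = - k * (k * integral {a..b} (\<lambda>t. g c (x t) (variation c X j t) (\<nu> t))) - k * K * ?q * integral {a..b} f"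
      unfolding recs by (simp add: algebra_simps)
    then show ?case unfolding Suc(2) by (simp add: algebra_simps)
  next case 2
    have "k * integral {a..b} (\<lambda>t. g c (x t) (variation c X (Suc j) t) (\<nu> t))
        = k * (k * integral {a..b} (\<lambda>t. g c (x t) (variation c X j t) (\<partial> 1 x t))) + k * K * ?p * integral {a..b} f"
      unfolding recs by (simp add: algebra_simps)
    then show ?case unfolding Suc(1) by (simp add: algebra_simps) }
qed

lemma energy_density_smooth: "smooth_on ({-e<..<e} \<times> J) (energy_density c X j)"
  unfolding energy_density_def[abs_def]
  by (rule smooth_on_bilinear_field[OF strip_open chart_im_open[OF c] X tangent_deriv_smooth tangent_deriv_smooth XS
        metric_bilinear[OF c] metric_smooth[OF c]])

lemma first_variation:
  "k * integral {a..b} (\<lambda>t. \<partial> (1, 0) (energy_density c X j) (0, t))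
    = 2 * (cmod ((\<i> * complex_of_real k) ^ j))\<^sup>2 * integral {a..b} f * (real j * K - k\<^sup>2)"
proof -
  let ?p = "Re ((\<i> * complex_of_real k) ^ j)" and ?q = "Im ((\<i> * complex_of_real k) ^ j)"
  have "integral {a..b} (\<lambda>t. \<partial> (1, 0) (energy_density c X j) (0, t))
     = integral {a..b} (\<lambda>t. (2 * ?p) * g c (x t) (variation c X j t) (\<partial> 1 x t) + (2 * ?q) * g c (x t) (variation c X j t) (\<nu> t))"
  proof (rule integral_cong)
    fix t assume "t \<in> {a..b}"
    then have t: "t \<in> J" using ab by auto
    have xt: "x t \<in> chart_im c" using xJ t by blast
    have V: "tangent_deriv c X j (0, t) = ?p *\<^sub>R \<partial> 1 x t + ?q *\<^sub>R \<nu> t"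
      unfolding tangent_deriv_0[OF t] by (rule iterated_covd_tangent(2)[OF t])
    have "\<partial> (1, 0) (energy_density c X j) (0, t)
        = g c (x t) (variation c X j t) (tangent_deriv c X j (0, t)) + g c (x t) (tangent_deriv c X j (0, t)) (variation c X j t)" (is "_ = _ + ?r")
      unfolding energy_density_def[abs_def]
        dir_deriv_metric_along[OF c strip_open X XS tangent_deriv_smooth tangent_deriv_smooth strip_0[OF t]] X0[OF t] variation_def ..
    also have "?r = g c (x t) (variation c X j t) (tangent_deriv c X j (0, t))" by (rule metric_sym[OF c xt])
    finally show "\<partial> (1, 0) (energy_density c X j) (0, t)
        = (2 * ?p) * g c (x t) (variation c X j t) (\<partial> 1 x t) + (2 * ?q) * g c (x t) (variation c X j t) (\<nu> t)"
      unfolding V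
      by (simp add: bilinear_radd[OF metric_bilinear[OF c xt]] bilinear_rmul[OF metric_bilinear[OF c xt]])
  qed
  also have "\<dots> = 2 * ?p * integral {a..b} (\<lambda>t. g c (x t) (variation c X j t) (\<partial> 1 x t))
      + 2 * ?q * integral {a..b} (\<lambda>t. g c (x t) (variation c X j t) (\<nu> t))"
    by (subst integral_add)
       (auto intro!: integrable_on_mult_right integrable_metric_along variation_smooth T_smooth \<nu>)
  finally have "k * integral {a..b} (\<lambda>t. \<partial> (1, 0) (energy_density c X j) (0, t))
      = 2 * ?p * (k * integral {a..b} (\<lambda>t. g c (x t) (variation c X j t) (\<partial> 1 x t)))
      + 2 * ?q * (k * integral {a..b} (\<lambda>t. g c (x t) (variation c X j t) (\<nu> t)))"
    by (simp add: algebra_simps)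
  then show ?thesis
    unfolding integral_variation cmod_power2 by (simp add: algebra_simps power2_eq_square)
qed

end

end

end

context riemannian_manifold
begin

section \<open>Smooth maps into the manifold\<close>

lemma smooth_into_vimage_open:
  assumes "smooth_into N S F" "open S" "d \<in> atlas N"
  shows "open (S \<inter> F -` chart_dom d)"
proof -
  have "openin (top_of_set S) {p \<in> topspace (top_of_set S). F p \<in> chart_dom d}"
    by (rule openin_continuous_map_preimage[OF _ chart_dom_open[OF assms(3)]])
       (use assms(1) in \<open>simp add: smooth_into_def\<close>)
  then have "open {p \<in> S. F p \<in> chart_dom d}" using openin_open_trans assms(2) by auto
  then show ?thesis by (simp add: vimage_def Int_def)
qed

lemma smooth_into_smooth_on:
  "smooth_into N S F \<Longrightarrow> d \<in> atlas N \<Longrightarrow> smooth_on (S \<inter> F -` chart_dom d) (\<lambda>p. coord d (F p))"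
  by (simp add: smooth_into_def)

lemma smooth_into_cong:
  assumes "open S" "smooth_into N S F" "\<And>p. p \<in> S \<Longrightarrow> F p = G p"
  shows "smooth_into N S G"
proof -
  have "continuous_map (top_of_set S) (top_of N) G"
    using assms(2,3) by (auto simp: smooth_into_def elim: continuous_map_eq)
  moreover have "smooth_on (S \<inter> G -` chart_dom d) (\<lambda>p. coord d (G p))" if d: "d \<in> atlas N" for d
  proof -
    have eq: "S \<inter> G -` chart_dom d = S \<inter> F -` chart_dom d" using assms(3) by auto
    show ?thesis unfolding eq
      by (rule smooth_on_cong[OF smooth_into_vimage_open[OF assms(2,1) d] smooth_into_smooth_on[OF assms(2) d]])
         (simp add: assms(3))
  qed
  ultimately show ?thesis by (simp add: smooth_into_def)
qed

lemma smooth_into_local: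
  assumes "\<And>p. p \<in> S \<Longrightarrow> \<exists>T. open T \<and> p \<in> T \<and> T \<subseteq> S \<and> smooth_into N T F"
  shows "smooth_into N S F"
proof -
  have "openin (top_of_set S) {p \<in> S. F p \<in> W}" if W: "openin (top_of N) W" for W
  proof -
    have "\<exists>A. open A \<and> p \<in> A \<and> A \<subseteq> {p \<in> S. F p \<in> W}" if p: "p \<in> S" "F p \<in> W" for p
    proof -
      obtain T where T: "open T" "p \<in> T" "T \<subseteq> S" "smooth_into N T F" using assms p by blast
      have "openin (top_of_set T) {p \<in> topspace (top_of_set T). F p \<in> W}"
        using T(4) W unfolding smooth_into_def by (intro openin_continuous_map_preimage) auto
      then have "open {p \<in> T. F p \<in> W}" using openin_open_trans T(1) by auto
      then show ?thesis using T p by (intro exI[of _ "{p \<in> T. F p \<in> W}"]) auto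
    qed
    then have "open {p \<in> S. F p \<in> W}" by (subst open_subopen) auto
    then show ?thesis
      using openin_open_Int[of "{p \<in> S. F p \<in> W}" S] by (simp add: Int_absorb1 Collect_conj_eq)
  qed
  moreover have "F ` S \<subseteq> topspace (top_of N)"
    using assms by (fastforce simp: smooth_into_def continuous_map_def)
  ultimately have "continuous_map (top_of_set S) (top_of N) F"
    by (auto simp: continuous_map_def)
  moreover have "smooth_on (S \<inter> F -` chart_dom d) (\<lambda>p. coord d (F p))" if d: "d \<in> atlas N" for d
  proof (rule smooth_on_local)
    fix p assume p: "p \<in> S \<inter> F -` chart_dom d"
    then obtain T where T: "open T" "p \<in> T" "T \<subseteq> S" "smooth_into N T F" using assms by blast
    show "\<exists>T. open T \<and> p \<in> T \<and> smooth_on T (\<lambda>p. coord d (F p))"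
      using smooth_into_vimage_open[OF T(4,1) d] smooth_into_smooth_on[OF T(4) d] T(2) p by blast
  qed
  ultimately show ?thesis by (simp add: smooth_into_def)
qed

lemma smooth_into_compose:
  fixes k :: "'p::euclidean_space \<Rightarrow> 'q::euclidean_space"
  assumes h: "smooth_into N T h" and S: "open S" and T: "open T" and k: "smooth_on S k" "k ` S \<subseteq> T"
  shows "smooth_into N S (\<lambda>p. h (k p))"
proof -
  have kc: "continuous_map (top_of_set S) (top_of_set T) k"
    using smooth_on_continuous[OF k(1)] k(2) by auto
  have "continuous_map (top_of_set T) (top_of N) h"
    using h by (simp add: smooth_into_def)
  from continuous_map_compose[OF kc this]
  have c: "continuous_map (top_of_set S) (top_of N) (\<lambda>p. h (k p))" by (simp add: o_def)
  moreover have "smooth_on (S \<inter> (\<lambda>p. h (k p)) -` chart_dom d) (\<lambda>p. coord d (h (k p)))" if d: "d \<in> atlas N" for d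
  proof -
    have "open (S \<inter> k -` (T \<inter> h -` chart_dom d))"
      by (rule continuous_open_preimage[OF smooth_on_continuous[OF k(1)] S smooth_into_vimage_open[OF h T d]])
    moreover have "S \<inter> k -` (T \<inter> h -` chart_dom d) = S \<inter> (\<lambda>p. h (k p)) -` chart_dom d" using k(2) by auto
    ultimately have o: "open (S \<inter> (\<lambda>p. h (k p)) -` chart_dom d)" by simp
    show ?thesis
      by (rule smooth_on_compose[OF o smooth_into_vimage_open[OF h T d] smooth_into_smooth_on[OF h d]
            smooth_on_subset[OF k(1)]]) (use k(2) in auto)
  qed
  ultimately show ?thesis by (simp add: smooth_into_def)
qed

lemma smooth_into_chart_inverse:
  fixes X :: "'p::euclidean_space \<Rightarrow> 'e"
  assumes c: "c \<in> atlas N" and S: "open S" and X: "smooth_on S X" "X ` S \<subseteq> chart_im c"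
  shows "smooth_into N S (\<lambda>p. inv_into (chart_dom c) (coord c) (X p))"
proof -
  have dc: "topspace (subtopology (top_of N) (chart_dom c)) = chart_dom c"
    using chart_dom_open[OF c] openin_subset by (metis topspace_subtopology_subset)
  obtain h where h: "continuous_map (top_of_set (chart_im c)) (subtopology (top_of N) (chart_dom c)) h"
      "\<And>q. q \<in> chart_dom c \<Longrightarrow> h (coord c q) = q"
    using chart_homeomorphic[OF c] dc unfolding homeomorphic_map_maps homeomorphic_maps_def by auto
  have Xc: "continuous_map (top_of_set S) (top_of_set (chart_im c)) X"
    using smooth_on_continuous[OF X(1)] X(2) by auto
  have "continuous_map (top_of_set S) (top_of N) (h \<circ> X)"
    using continuous_map_compose[OF Xc h(1)] continuous_map_into_fulltopology by blast
  then have "continuous_map (top_of_set S) (top_of N) (\<lambda>p. inv_into (chart_dom c) (coord c) (X p))"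
  proof (rule continuous_map_eq)
    fix p assume "p \<in> topspace (top_of_set S)"
    then obtain q where "q \<in> chart_dom c" "X p = coord c q" using X(2) by auto
    then show "(h \<circ> X) p = inv_into (chart_dom c) (coord c) (X p)"
      using h(2) inv_into_f_f[OF chart_inj[OF c]] by simp
  qed
  moreover have "smooth_on (S \<inter> (\<lambda>p. inv_into (chart_dom c) (coord c) (X p)) -` chart_dom d)
       (\<lambda>p. coord d (inv_into (chart_dom c) (coord c) (X p)))" if d: "d \<in> atlas N" for d
  proof -
    let ?W = "coord c ` (chart_dom c \<inter> chart_dom d)"
    have W: "open ?W"
      using open_coord_image[OF c openin_Int[OF chart_dom_open[OF c] chart_dom_open[OF d]]] by auto
    have eq: "S \<inter> (\<lambda>p. inv_into (chart_dom c) (coord c) (X p)) -` chart_dom d = S \<inter> X -` ?W"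
    proof (intro set_eqI iffI)
      fix p assume p: "p \<in> S \<inter> (\<lambda>p. inv_into (chart_dom c) (coord c) (X p)) -` chart_dom d"
      then have "X p \<in> chart_im c" using X(2) by auto
      from f_inv_into_f[OF this] inv_into_into[OF this] p show "p \<in> S \<inter> X -` ?W"
        by (metis IntD1 IntD2 IntI imageI vimageE vimageI)
    next
      fix p assume "p \<in> S \<inter> X -` ?W"
      then show "p \<in> S \<inter> (\<lambda>p. inv_into (chart_dom c) (coord c) (X p)) -` chart_dom d"
        using inv_into_f_f[OF chart_inj[OF c]] by auto
    qed
    have o: "open (S \<inter> X -` ?W)"
      by (rule continuous_open_preimage[OF smooth_on_continuous[OF X(1)] S W])
    show ?thesis
      unfolding eq transition_def[symmetric]
      by (rule smooth_on_compose[OF o W transition_smooth[OF c d] smooth_on_subset[OF X(1)]]) auto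
  qed
  ultimately show ?thesis by (simp add: smooth_into_def)
qed

end

section \<open>Polyharmonic curves of constant geodesic curvature\<close>

text \<open>It suffices to work near one point \<open>t0\<close> of the curve, inside one chart, with a variation in the
  normal direction whose profile \<open>f\<close> is a bump function.\<close>

lemma (in riemannian_surface) geodesic_curvature_of_polyharmonic_curve:
  assumes K: "constant_sectional_curvature N K"
    and I: "open I"
    and kh: "k_harmonic N (2 * s + 1) I \<gamma>"
    and al: "arc_length_param N I \<gamma>"
    and fr: "frenet_frame N I \<gamma> n (\<lambda>t. k)"
    and t0: "t0 \<in> I" and k: "k \<noteq> 0"
  shows "k\<^sup>2 = 2 * real s * K"
proof -
  have sm: "smooth_into N I \<gamma>" using kh by (simp add: k_harmonic_def)
  have "\<gamma> t0 \<in> topspace (top_of N)"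
    using sm t0 by (auto simp: smooth_into_def continuous_map_def)
  then obtain c where c: "c \<in> atlas N" and ct: "\<gamma> t0 \<in> chart_dom c" using atlas_covers by blast
  define J where "J = I \<inter> \<gamma> -` chart_dom c"
  have J: "open J" unfolding J_def by (rule smooth_into_vimage_open[OF sm I c])
  have JI: "J \<subseteq> I" and \<gamma>J: "\<gamma> ` J \<subseteq> chart_dom c" and t0J: "t0 \<in> J" using t0 ct by (auto simp: J_def)
  obtain \<delta> where \<delta>: "\<delta> > 0" "cball t0 \<delta> \<subseteq> J" using J t0J open_contains_cball by blast
  \<comment> \<open>The bump function will be supported in \<open>{a'..b'}\<close>; at the ends of the larger interval \<open>{a..b}\<close>, over which the
    energy is integrated, the variation field and its derivatives vanish.\<close>
  define a where "a = t0 - \<delta>"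
  define b where "b = t0 + \<delta>"
  define a' where "a' = t0 - \<delta> / 2"
  define b' where "b' = t0 + \<delta> / 2"
  have ab: "a < a'" "a' < b'" "b' < b" "a \<le> b" using \<delta> by (auto simp: a_def b_def a'_def b'_def)
  have abJ: "{a..b} \<subseteq> J" using \<delta> by (auto simp: a_def b_def cball_eq_atLeastAtMost)
  then have a'b'J: "{a'..b'} \<subseteq> J" using ab by auto
  obtain f :: "real \<Rightarrow> real" where f: "smooth_on UNIV f" "\<And>t. f t \<noteq> 0 \<Longrightarrow> a' < t \<and> t < b'"
    "integral {a'..b'} f \<noteq> 0" using bump_function_exists[OF ab(2)] by blast
  have f0: "f t = 0" if "t \<notin> {a'..b'}" for t using f(2)[of t] that by fastforce
  have fi: "integral {a..b} f \<noteq> 0"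
  proof -
    have "f integrable_on {a'..b'}"
      by (rule integrable_continuous_interval[OF continuous_on_subset[OF smooth_on_continuous[OF f(1)]]]) simp
    then have "(f has_integral integral {a'..b'} f) {a..b}"
      by (intro has_integral_on_superset[OF integrable_integral f0]) (use ab in auto)
    then have "integral {a..b} f = integral {a'..b'} f" by (rule integral_unique)
    then show ?thesis using f(3) by simp
  qed
  define x where "x t = coord c (\<gamma> t)" for t
  define \<nu> where "\<nu> t = n t c" for t
  have x: "smooth_on J x" unfolding x_def[abs_def] J_def by (rule smooth_into_smooth_on[OF sm c])
  have xJ: "x ` J \<subseteq> chart_im c" using \<gamma>J by (auto simp: x_def)
  have \<nu>: "smooth_on J \<nu>" unfolding \<nu>_def[abs_def] J_def
    using fr c by (auto simp: frenet_frame_def smooth_field_along_def)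
  have op: "open (J \<inter> \<gamma> -` chart_dom d)" if "d \<in> atlas N" for d
    using open_Int[OF J smooth_into_vimage_open[OF sm I that]] JI by (simp add: Int_absorb2 inf_assoc[symmetric])
  have vel: "velocity \<gamma> t c = \<partial> 1 x t" if "t \<in> J" for t
    using velocity_in_chart[OF c J \<gamma>J, of t] x that op by (simp add: x_def[abs_def])
  have velt: "velocity \<gamma> t d = \<partial> (velocity \<gamma> t c) (transition c d) (coord c (\<gamma> t))"
    if "t \<in> J" "d \<in> atlas N" "\<gamma> t \<in> chart_dom d" for t d
    using iterated_cov_deriv_tangent[OF c J \<gamma>J _ op that, of 0] x by (simp add: x_def[abs_def])
  have nt: "n t d = \<partial> (n t c) (transition c d) (coord c (\<gamma> t))"
    if "t \<in> J" "d \<in> atlas N" "\<gamma> t \<in> chart_dom d" for t d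
    using fr that c JI \<gamma>J unfolding frenet_frame_def smooth_field_along_def tangent_vector_def by blast
  have ctJ: "\<gamma> t \<in> chart_dom c" if "t \<in> J" for t using that \<gamma>J by blast
  have TT: "g c (x t) (\<partial> 1 x t) (\<partial> 1 x t) = 1" if t: "t \<in> J" for t
    using riem_inner_in_chart[OF c ctJ[OF t] velt[OF t] velt[OF t]] al t JI vel[OF t]
    by (auto simp: arc_length_param_def x_def)
  have \<nu>\<nu>: "g c (x t) (\<nu> t) (\<nu> t) = 1" if t: "t \<in> J" for t
    using riem_inner_in_chart[OF c ctJ[OF t] nt[OF t] nt[OF t]] fr t JI
    by (auto simp: frenet_frame_def x_def \<nu>_def)
  have \<nu>T: "g c (x t) (\<nu> t) (\<partial> 1 x t) = 0" if t: "t \<in> J" for t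
    using riem_inner_in_chart[OF c ctJ[OF t] nt[OF t] velt[OF t]] fr t JI vel[OF t]
    by (auto simp: frenet_frame_def x_def \<nu>_def)
  have velsm: "smooth_on J (\<lambda>t. velocity \<gamma> t c)"
    by (rule smooth_on_cong[OF J smooth_on_dir_deriv[OF x]]) (simp add: vel)
  have nabT: "covd c x 1 (\<partial> 1 x) t = k *\<^sub>R \<nu> t" if t: "t \<in> J" for t
  proof -
    have "covd c x 1 (\<partial> 1 x) t = covd c x 1 (\<lambda>t. velocity \<gamma> t c) t"
      by (rule covd_cong[OF c J x xJ smooth_on_dir_deriv[OF x] _ t]) (simp add: vel)
    also have "\<dots> = cov_deriv N \<gamma> (velocity \<gamma>) t c"
      using cov_deriv_in_chart[where V = "velocity \<gamma>", OF c J \<gamma>J _ op velsm t] x by (simp add: x_def[abs_def])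
    also have "\<dots> = k *\<^sub>R \<nu> t"
      using fr t JI c ctJ[OF t] by (auto simp: frenet_frame_def tangent_eq_def \<nu>_def)
    finally show ?thesis .
  qed
  have nab\<nu>: "covd c x 1 \<nu> t = (- k) *\<^sub>R \<partial> 1 x t" if t: "t \<in> J" for t
  proof -
    have "covd c x 1 \<nu> t = cov_deriv N \<gamma> n t c"
      using cov_deriv_in_chart[where V = n, OF c J \<gamma>J _ op _ t] x \<nu> by (simp add: x_def[abs_def] \<nu>_def[abs_def])
    also have "\<dots> = (- k) *\<^sub>R \<partial> 1 x t"
      using fr t JI c ctJ[OF t] vel[OF t] by (auto simp: frenet_frame_def tangent_eq_def)
    finally show ?thesis .
  qed
  \<comment> \<open>The variation \<open>x + r f \<nu>\<close> stays in the image of the chart if \<open>r\<close> is small: on the support of \<open>f\<close>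
    by compactness, and elsewhere it is \<open>x\<close>.\<close>
  obtain \<epsilon> where \<epsilon>: "\<epsilon> > 0" "(\<Union>y\<in>x ` {a'..b'}. ball y \<epsilon>) \<subseteq> chart_im c"
  proof (rule compact_subset_open_imp_ball_epsilon_subset)
    show "compact (x ` {a'..b'})"
      by (rule compact_continuous_image[OF continuous_on_subset[OF smooth_on_continuous[OF x] a'b'J]]) simp
    show "open (chart_im c)" by (rule chart_im_open[OF c])
    show "x ` {a'..b'} \<subseteq> chart_im c" using xJ a'b'J by auto
  qed (use that in auto)
  have f\<nu>: "smooth_on J (\<lambda>t. f t *\<^sub>R \<nu> t)"
    by (intro smooth_on_scaleR J \<nu> smooth_on_subset[OF f(1)]) simp
  have "bounded ((\<lambda>t. f t *\<^sub>R \<nu> t) ` {a'..b'})"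
    by (intro compact_imp_bounded compact_continuous_image
        continuous_on_subset[OF smooth_on_continuous[OF f\<nu>] a'b'J]) simp
  then obtain M where M: "M > 0" "\<And>t. t \<in> {a'..b'} \<Longrightarrow> norm (f t *\<^sub>R \<nu> t) \<le> M"
    unfolding bounded_pos by auto
  define e where "e = \<epsilon> / M"
  have e: "e > 0" using \<epsilon> M by (simp add: e_def)
  define X where "X p = x (snd p) + fst p *\<^sub>R f (snd p) *\<^sub>R \<nu> (snd p)" for p :: "real \<times> real"
  let ?S = "{-e<..<e} \<times> J"
  have S: "open ?S" by (intro open_Times J open_greaterThanLessThan)
  have X: "smooth_on ?S X"
    unfolding X_def
    by (intro smooth_on_add smooth_on_scaleR S smooth_on_bounded_linear bounded_linear_fst
        smooth_on_compose[OF S J x] smooth_on_compose[OF S J \<nu>] smooth_on_compose[OF S open_UNIV f(1)]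
        bounded_linear_snd) auto
  have XS: "X ` ?S \<subseteq> chart_im c"
  proof (intro image_subsetI)
    fix p assume p: "p \<in> ?S"
    obtain r t where rt: "p = (r, t)" by fastforce
    have r: "\<bar>r\<bar> < e" and t: "t \<in> J" using p rt by auto
    show "X p \<in> chart_im c"
    proof (cases "t \<in> {a'..b'}")
      case True
      have "norm (r *\<^sub>R f t *\<^sub>R \<nu> t) \<le> \<bar>r\<bar> * M" using mult_left_mono[OF M(2)[OF True], of "\<bar>r\<bar>"] by (simp add: abs_mult mult.assoc)
      also have "\<dots> < \<epsilon>" using r M(1) by (simp add: e_def field_simps)
      finally have "X p \<in> ball (x t) \<epsilon>" by (simp add: X_def rt dist_norm)
      then show ?thesis using \<epsilon>(2) True by blast
    next
      case False
      then have "X p = x t" using f0 by (simp add: X_def rt)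
      then show ?thesis using xJ t by auto
    qed
  qed
  have X0: "X (0, t) = x t" for t by (simp add: X_def)
  have X1: "\<partial> (1, 0) X (0, t) = f t *\<^sub>R \<nu> t" if t: "t \<in> J" for t
  proof -
    have "X differentiable (at (0, t))" by (rule smooth_on_differentiable[OF X]) (use e t in auto)
    from has_derivative_dir_deriv[OF this]
    have D: "(X has_derivative (\<lambda>v. \<partial> v X (0, t))) (at (0, t))" .
    have "((\<lambda>r. (r, t)) has_derivative (\<lambda>h. (h, 0))) (at 0)"
      by (auto intro!: derivative_eq_intros)
    from has_derivative_compose[OF this D]
    have 1: "((\<lambda>r. X (r, t)) has_derivative (\<lambda>h. \<partial> (h, 0) X (0, t))) (at 0)" .
    have 2: "((\<lambda>r. X (r, t)) has_derivative (\<lambda>h. h *\<^sub>R f t *\<^sub>R \<nu> t)) (at 0)"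
      unfolding X_def by (auto intro!: derivative_eq_intros)
    from fun_cong[OF has_derivative_unique[OF 1 2], of 1] show ?thesis by simp
  qed
  \<comment> \<open>In the manifold the variation is continued by \<open>\<gamma>\<close> outside \<open>J\<close>.\<close>
  define F where "F r t = (if t \<in> J then inv_into (chart_dom c) (coord c) (X (r, t)) else \<gamma> t)" for r t
  have FJ: "F r t \<in> chart_dom c" "coord c (F r t) = X (r, t)" if "r \<in> {-e<..<e}" "t \<in> J" for r t
  proof -
    have "X (r, t) \<in> chart_im c" using XS that by blast
    then show "F r t \<in> chart_dom c" "coord c (F r t) = X (r, t)"
      unfolding F_def using that(2) by (auto simp: inv_into_into f_inv_into_f)
  qed
  have F0: "F r t = \<gamma> t" if "t \<in> I" "t \<notin> {a'..b'} \<or> r = 0" for r t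
  proof (cases "t \<in> J")
    case True
    have "X (r, t) = coord c (\<gamma> t)" using that(2) f0 by (auto simp: X_def x_def)
    then show ?thesis using True inv_into_f_f[OF chart_inj[OF c] ctJ[OF True]] by (simp add: F_def)
  qed (simp add: F_def)
  have smF: "smooth_into N ({-e<..<e} \<times> I) (\<lambda>(r, t). F r t)"
  proof (rule smooth_into_local)
    fix p assume p: "p \<in> {-e<..<e} \<times> I"
    have S2: "open ({-e<..<e} \<times> (I - {a'..b'}))"
      by (intro open_Times open_Diff I open_greaterThanLessThan closed_atLeastAtMost)
    have 1: "smooth_into N ?S (\<lambda>(r, t). F r t)"
      by (rule smooth_into_cong[OF S smooth_into_chart_inverse[OF c S X XS]]) (auto simp: F_def)
    have 2: "smooth_into N ({-e<..<e} \<times> (I - {a'..b'})) (\<lambda>(r, t). F r t)"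
      by (rule smooth_into_cong[OF S2 smooth_into_compose[OF sm S2 I, of snd]])
         (auto simp: F0 intro: smooth_on_bounded_linear bounded_linear_snd)
    show "\<exists>T. open T \<and> p \<in> T \<and> T \<subseteq> {-e<..<e} \<times> I \<and> smooth_into N T (\<lambda>(r, t). F r t)"
    proof (cases "snd p \<in> J")
      case True
      then show ?thesis using 1 S p JI by (intro exI[of _ ?S]) auto
    next
      case False
      then show ?thesis using 2 S2 p a'b'J
        by (intro exI[of _ "{-e<..<e} \<times> (I - {a'..b'})"]) auto
    qed
  qed
  have crit: "((\<lambda>r. k_energy N (2 * s + 1) {a..b} (F r)) has_real_derivative 0) (at 0)"
  proof -
    have "compact {a..b}" "{a..b} \<subseteq> I" "\<forall>t\<in>I. F 0 t = \<gamma> t" "\<forall>r\<in>{-e<..<e}. \<forall>t\<in>I - {a..b}. F r t = \<gamma> t"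
      using abJ JI F0 ab by auto
    then show ?thesis using kh e smF unfolding k_harmonic_def by blast
  qed
  \<comment> \<open>The energies of the varied curves are integrals of the density that is computed in the chart \<open>c\<close>.\<close>
  have en: "k_energy N (2 * s + 1) {a..b} (F r) = 1 / 2 * integral {a..b} (\<lambda>t. energy_density c X (2 * s) (r, t))"
    if r: "r \<in> {-e<..<e}" for r
  proof -
    have sl: "smooth_on I (\<lambda>t. (r, t))"
      using smooth_on_slice[OF open_UNIV smooth_on_bounded_linear[OF bounded_linear_ident] I] by simp
    have SI: "open ({-e<..<e} \<times> I)" by (intro open_Times I open_greaterThanLessThan)
    have "(\<lambda>t. (r, t)) ` I \<subseteq> {-e<..<e} \<times> I" using r by auto
    from smooth_into_compose[OF smF I SI sl this] have smFr: "smooth_into N I (F r)" by simp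
    have FrJ: "F r ` J \<subseteq> chart_dom c" using FJ[OF r] by auto
    have y: "smooth_on J (\<lambda>t. coord c (F r t))"
      by (rule smooth_on_cong[OF J smooth_on_slice[OF S X J]]) (use r FJ in auto)
    have opF: "open (J \<inter> F r -` chart_dom d)" if "d \<in> atlas N" for d
      using open_Int[OF J smooth_into_vimage_open[OF smFr I that]] JI by (simp add: Int_absorb2 inf_assoc[symmetric])
    have "riem_inner N (F r t) ((cov_deriv N (F r) ^^ (2 * s)) (velocity (F r)) t)
        ((cov_deriv N (F r) ^^ (2 * s)) (velocity (F r)) t) = energy_density c X (2 * s) (r, t)"
      if t: "t \<in> {a..b}" for t
    proof -
      have tJ: "t \<in> J" using t abJ by auto
      have JS: "{r} \<times> J \<subseteq> ?S" using r by auto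
      have yX: "X (r, t) = coord c (F r t)" if "t \<in> J" for t using FJ(2)[OF r that] by simp
      have "(covd c X (0, 1) ^^ (2 * s)) (\<partial> (0, 1) X) (r, t)
          = (covd c (\<lambda>t. coord c (F r t)) 1 ^^ (2 * s)) (\<partial> 1 (\<lambda>t. coord c (F r t))) t"
        by (rule iterated_covd_slice(2)[OF c S X XS J JS yX tJ])
      then show ?thesis
        using energy_density_in_chart[OF c J FrJ y opF tJ, of "2 * s"]
        by (simp add: Let_def energy_density_def tangent_deriv_def yX[OF tJ])
    qed
    then have "integral {a..b} (\<lambda>t. riem_inner N (F r t) ((cov_deriv N (F r) ^^ (2 * s)) (velocity (F r)) t)
        ((cov_deriv N (F r) ^^ (2 * s)) (velocity (F r)) t)) = integral {a..b} (\<lambda>t. energy_density c X (2 * s) (r, t))"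
      by (rule integral_cong)
    then show ?thesis by (simp add: k_energy_def Let_def)
  qed
  let ?D = "integral {a..b} (\<lambda>t. \<partial> (1, 0) (energy_density c X (2 * s)) (0, t))"
  have eds: "smooth_on ?S (energy_density c X (2 * s))"
    by (rule energy_density_smooth[where x = x and a = a and b = b and a' = a' and b' = b' and f = f and k = k and \<nu> = \<nu> and K = K])
      (use c J x xJ \<nu> nabT nab\<nu> TT \<nu>\<nu> \<nu>T ab abJ e X XS X0 X1 f f0 K in auto)
  have "((\<lambda>r. 1 / 2 * integral {a..b} (\<lambda>t. energy_density c X (2 * s) (r, t))) has_real_derivative 1 / 2 * ?D) (at 0)"
    by (rule DERIV_cmult[OF has_real_derivative_integral[OF J eds e abJ]])
  then have "((\<lambda>r. k_energy N (2 * s + 1) {a..b} (F r)) has_real_derivative 1 / 2 * ?D) (at 0)"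
    by (rule has_field_derivative_transform_within_open[where S = "{-e<..<e}"]) (use e en in auto)
  from DERIV_unique[OF crit this] have D0: "?D = 0" by simp
  have "k * ?D = 2 * (cmod ((\<i> * complex_of_real k) ^ (2 * s)))\<^sup>2 * integral {a..b} f * (real (2 * s) * K - k\<^sup>2)"
    by (rule first_variation[where x = x and a' = a' and b' = b' and e = e and \<nu> = \<nu>])
      (use c J x xJ \<nu> nabT nab\<nu> TT \<nu>\<nu> \<nu>T ab abJ e X XS X0 X1 f f0 K in auto)
  then show ?thesis using D0 k fi by simp
qed

theorem proposition5p7:
  fixes N :: "('a, real^2) riem"
    and s :: nat
    and K :: real
    and I :: "real set"
    and \<gamma> :: "real \<Rightarrow> 'a"
    and n :: "real \<Rightarrow> ('a, real^2) tangent"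
    and \<kappa> :: "real \<Rightarrow> real"
  assumes "riemannian_manifold N"
    and "constant_sectional_curvature N K"
    and "K \<ge> 0"
    and "open I" and "is_interval I"
    and "k_harmonic N (2 * s + 1) I \<gamma>"
    and "arc_length_param N I \<gamma>"
    and "frenet_frame N I \<gamma> n \<kappa>"
    and "\<kappa> constant_on I"
  shows "(\<forall>t\<in>I. \<kappa> t = 0) \<or> (\<forall>t\<in>I. \<bar>\<kappa> t\<bar> = sqrt (2 * real s * K))"
proof -
  interpret riemannian_surface N by (simp add: riemannian_surface_def assms(1))
  obtain k where k: "\<And>t. t \<in> I \<Longrightarrow> \<kappa> t = k" using assms(9) by (auto simp: constant_on_def)
  have fr: "frenet_frame N I \<gamma> n (\<lambda>t. k)" using assms(8) k by (simp add: frenet_frame_def)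
  have "\<bar>\<kappa> t\<bar> = sqrt (2 * real s * K)" if "t \<in> I" "k \<noteq> 0" for t
    using geodesic_curvature_of_polyharmonic_curve[OF assms(2,4,6,7) fr that] k[OF that(1)] by (metis real_sqrt_abs)
  then show ?thesis using k by blast
qed

end
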